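(* Let $X$ and $Y$ be infinite-dimensional normed linear spaces over $\mathbb{C}$ and let $T\in B(X,Y)$. Suppose that there exist operators $P_n\in B(X)$ and $Q_n\in B(Y)$, $n\in\mathbb{N}$, such that for all $n\in\mathbb{N}$, $T_n := Q_n T P_n$ is a compact operator in $B(X,Y)$ and $\|P_n\|\,\|Q_n\|\le 1$, and such that $(T_n)$ converges to $T$ in the weak sense of operator convergence. Then for each $k\in\mathbb{N}$, $$\lim_{n\to\infty} a_k(T_n)=a_k(T) \iff a_k(T)=a_k(T').$$
   Context: For normed linear spaces $X, Y$ over $\mathbb{C}$, $B(X,Y)$ is the space of bounded linear operators from $X$ to $Y$ with the operator norm, $B(X)=B(X,X)$ and $X'=B(X,\mathbb{C})$. The adjoint of $T\in B(X,Y)$ is $T'\in B(Y',X')$, $(T'f)(x)=f(Tx)$ for $x\in X$, $f\in Y'$. For $k\in\mathbb{N}=\{1,2,\dots\}$, $\mathcal{F}_k(X,Y)$ is the set of all finite-rank operators in $B(X,Y)$ of rank less than $k$, and the $k$-th approximation number of $T\in B(X,Y)$ is $a_k(T)=\inf\{\|T-F\| : F\in\mathcal{F}_k(X,Y)\}$. A sequence $(T_n)$ in $B(X,Y)$ converges to $T$ in the weak sense of operator convergence if for each $f\in Y'$ and $x\in X$, $|f(T_nx)-f(Tx)|\to 0$. *)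

theory Defs
  imports "HOL-Analysis.Analysis"
begin

section \<open>Complex normed spaces\<close>

class scaleC =
  fixes scaleC :: "complex \<Rightarrow> 'a \<Rightarrow> 'a" (infixr \<open>*\<^sub>C\<close> 75)

text \<open>The last axiom says that the scalar multiplication by reals inherited from
  \<^class>\<open>real_vector\<close> is the restriction of the complex one, so a complex normed space
  carries its usual real normed structure, metric and topology.\<close>

class complex_vector = real_vector + scaleC +
  assumes scaleC_add_right: "a *\<^sub>C (x + y) = a *\<^sub>C x + a *\<^sub>C y"
    and scaleC_add_left: "(a + b) *\<^sub>C x = a *\<^sub>C x + b *\<^sub>C x"
    and scaleC_scaleC: "a *\<^sub>C b *\<^sub>C x = (a * b) *\<^sub>C x"
    and scaleC_one: "1 *\<^sub>C x = x"
    and scaleR_scaleC: "r *\<^sub>R x = complex_of_real r *\<^sub>C x"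

class complex_normed_vector = complex_vector + real_normed_vector +
  assumes norm_scaleC: "norm (a *\<^sub>C x) = cmod a * norm x"

instantiation complex :: complex_normed_vector
begin

definition scaleC_complex :: "complex \<Rightarrow> complex \<Rightarrow> complex"
  where "scaleC_complex a x = a * x"

instance
  by standard
    (simp_all add: scaleC_complex_def algebra_simps norm_mult scaleR_conv_of_real)

end

global_interpretation complex_vector:
  vector_space "scaleC :: complex \<Rightarrow> 'a \<Rightarrow> 'a::complex_vector"
  defines cspan = complex_vector.span
    and cdependent = complex_vector.dependent
    and csubspace = complex_vector.subspace
    and crepresentation = complex_vector.representation
    and cextend_basis = complex_vector.extend_basis
    and cdim = complex_vector.dim
  by unfold_locales
    (simp_all add: scaleC_add_right scaleC_add_left scaleC_scaleC scaleC_one)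

text \<open>The dimension \<^const>\<open>cdim\<close> of an infinite-dimensional space is \<open>0\<close>, so finiteness of
  the dimension has to be stated separately.\<close>

definition finite_cdim :: "'a::complex_vector set \<Rightarrow> bool"
  where "finite_cdim V \<longleftrightarrow> (\<exists>B. finite B \<and> V \<subseteq> cspan B)"


section \<open>Bounded complex-linear operators\<close>

definition bounded_clinear :: "('a::complex_normed_vector \<Rightarrow> 'b::complex_normed_vector) \<Rightarrow> bool"
  where "bounded_clinear f \<longleftrightarrow> bounded_linear f \<and> (\<forall>c x. f (c *\<^sub>C x) = c *\<^sub>C f x)"

lemma bounded_clinear_bounded_linear: "bounded_clinear f \<Longrightarrow> bounded_linear f"
  by (simp add: bounded_clinear_def)

lemma bounded_clinear_zero: "bounded_clinear (\<lambda>x. 0)"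
  by (simp add: bounded_clinear_def)

lemma bounded_clinear_add:
  "bounded_clinear f \<Longrightarrow> bounded_clinear g \<Longrightarrow> bounded_clinear (\<lambda>x. f x + g x)"
  by (simp add: bounded_clinear_def bounded_linear_add scaleC_add_right)

lemma bounded_clinear_minus: "bounded_clinear f \<Longrightarrow> bounded_clinear (\<lambda>x. - f x)"
  by (simp add: bounded_clinear_def bounded_linear_minus)

lemma bounded_clinear_sub:
  "bounded_clinear f \<Longrightarrow> bounded_clinear g \<Longrightarrow> bounded_clinear (\<lambda>x. f x - g x)"
  by (simp add: bounded_clinear_def bounded_linear_sub complex_vector.scale_right_diff_distrib)

lemma bounded_linear_scaleC_right:
  "bounded_linear (scaleC c :: 'a \<Rightarrow> 'a::complex_normed_vector)"
  by (rule bounded_linear_intro[where K = "cmod c"])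
    (simp_all add: scaleC_add_right scaleR_scaleC scaleC_scaleC norm_scaleC mult.commute)

lemma bounded_clinear_scaleC:
  "bounded_clinear f \<Longrightarrow> bounded_clinear (\<lambda>x. c *\<^sub>C f x)"
  by (simp add: bounded_clinear_def bounded_linear_compose[OF bounded_linear_scaleC_right]
      scaleC_scaleC mult.commute)

lemma bounded_clinear_scaleR:
  "bounded_clinear f \<Longrightarrow> bounded_clinear (\<lambda>x. r *\<^sub>R f x)"
  by (simp add: scaleR_scaleC bounded_clinear_scaleC)

lemma bounded_clinear_compose:
  "bounded_clinear f \<Longrightarrow> bounded_clinear g \<Longrightarrow> bounded_clinear (\<lambda>x. f (g x))"
  by (simp add: bounded_clinear_def bounded_linear_compose)

lemma onorm_scaleC:
  assumes "bounded_clinear f"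
  shows "onorm (\<lambda>x. c *\<^sub>C f x) = cmod c * onorm f"
proof (rule antisym)
  have bound: "onorm (\<lambda>x. d *\<^sub>C g x) \<le> cmod d * onorm g" if g: "bounded_clinear g"
    for d and g :: "'a \<Rightarrow> 'b"
  proof (rule onorm_bound)
    show "0 \<le> cmod d * onorm g"
      by (simp add: onorm_pos_le[OF bounded_clinear_bounded_linear[OF g]])
    show "norm (d *\<^sub>C g x) \<le> cmod d * onorm g * norm x" for x
      using mult_left_mono[OF onorm[OF bounded_clinear_bounded_linear[OF g], of x], of "cmod d"]
      by (simp add: norm_scaleC mult.assoc)
  qed
  show "onorm (\<lambda>x. c *\<^sub>C f x) \<le> cmod c * onorm f"
    by (rule bound[OF assms])
  show "cmod c * onorm f \<le> onorm (\<lambda>x. c *\<^sub>C f x)"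
  proof (cases "c = 0")
    case True
    then show ?thesis
      by (simp add: onorm_pos_le[OF bounded_clinear_bounded_linear] bounded_clinear_zero)
  next
    case False
    have "onorm f = onorm (\<lambda>x. inverse c *\<^sub>C c *\<^sub>C f x)"
      using False by (simp add: scaleC_scaleC scaleC_one)
    also have "\<dots> \<le> cmod (inverse c) * onorm (\<lambda>x. c *\<^sub>C f x)"
      by (rule bound[OF bounded_clinear_scaleC[OF assms]])
    finally show ?thesis
      using False by (simp add: norm_inverse norm_divide field_simps)
  qed
qed

typedef (overloaded) ('a, 'b) cblinfun (\<open>(_ \<Rightarrow>\<^sub>C\<^sub>L /_)\<close> [22, 21] 21) =
  "{f :: 'a::complex_normed_vector \<Rightarrow> 'b::complex_normed_vector. bounded_clinear f}"
  morphisms cblinfun_apply CBlinfun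
  by (blast intro: bounded_clinear_zero)

setup_lifting type_definition_cblinfun

declare [[coercion
    "cblinfun_apply :: ('a::complex_normed_vector \<Rightarrow>\<^sub>C\<^sub>L 'b::complex_normed_vector) \<Rightarrow> 'a \<Rightarrow> 'b"]]

instantiation cblinfun :: (complex_normed_vector, complex_normed_vector) complex_normed_vector
begin

lift_definition norm_cblinfun :: "'a \<Rightarrow>\<^sub>C\<^sub>L 'b \<Rightarrow> real" is onorm .

lift_definition minus_cblinfun :: "'a \<Rightarrow>\<^sub>C\<^sub>L 'b \<Rightarrow> 'a \<Rightarrow>\<^sub>C\<^sub>L 'b \<Rightarrow> 'a \<Rightarrow>\<^sub>C\<^sub>L 'b"
  is "\<lambda>f g x. f x - g x"
  by (rule bounded_clinear_sub)

definition dist_cblinfun :: "'a \<Rightarrow>\<^sub>C\<^sub>L 'b \<Rightarrow> 'a \<Rightarrow>\<^sub>C\<^sub>L 'b \<Rightarrow> real"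
  where "dist_cblinfun a b = norm (a - b)"

definition uniformity_cblinfun :: "(('a \<Rightarrow>\<^sub>C\<^sub>L 'b) \<times> ('a \<Rightarrow>\<^sub>C\<^sub>L 'b)) filter"
  where "uniformity_cblinfun = (INF e\<in>{0 <..}. principal {(x, y). dist x y < e})"

definition open_cblinfun :: "('a \<Rightarrow>\<^sub>C\<^sub>L 'b) set \<Rightarrow> bool"
  where "open_cblinfun S = (\<forall>x\<in>S. \<forall>\<^sub>F (x', y) in uniformity. x' = x \<longrightarrow> y \<in> S)"

lift_definition uminus_cblinfun :: "'a \<Rightarrow>\<^sub>C\<^sub>L 'b \<Rightarrow> 'a \<Rightarrow>\<^sub>C\<^sub>L 'b" is "\<lambda>f x. - f x"
  by (rule bounded_clinear_minus)

lift_definition zero_cblinfun :: "'a \<Rightarrow>\<^sub>C\<^sub>L 'b" is "\<lambda>x. 0"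
  by (rule bounded_clinear_zero)

lift_definition plus_cblinfun :: "'a \<Rightarrow>\<^sub>C\<^sub>L 'b \<Rightarrow> 'a \<Rightarrow>\<^sub>C\<^sub>L 'b \<Rightarrow> 'a \<Rightarrow>\<^sub>C\<^sub>L 'b"
  is "\<lambda>f g x. f x + g x"
  by (rule bounded_clinear_add)

lift_definition scaleR_cblinfun :: "real \<Rightarrow> 'a \<Rightarrow>\<^sub>C\<^sub>L 'b \<Rightarrow> 'a \<Rightarrow>\<^sub>C\<^sub>L 'b"
  is "\<lambda>r f x. r *\<^sub>R f x"
  by (rule bounded_clinear_scaleR)

lift_definition scaleC_cblinfun :: "complex \<Rightarrow> 'a \<Rightarrow>\<^sub>C\<^sub>L 'b \<Rightarrow> 'a \<Rightarrow>\<^sub>C\<^sub>L 'b"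
  is "\<lambda>c f x. c *\<^sub>C f x"
  by (rule bounded_clinear_scaleC)

definition sgn_cblinfun :: "'a \<Rightarrow>\<^sub>C\<^sub>L 'b \<Rightarrow> 'a \<Rightarrow>\<^sub>C\<^sub>L 'b"
  where "sgn_cblinfun x = scaleR (inverse (norm x)) x"

instance
proof
  fix f g h :: "'a \<Rightarrow>\<^sub>C\<^sub>L 'b" and S :: "('a \<Rightarrow>\<^sub>C\<^sub>L 'b) set" and r s :: real and a b :: complex
  show "dist f g = norm (f - g)"
    by (rule dist_cblinfun_def)
  show "(uniformity :: (('a \<Rightarrow>\<^sub>C\<^sub>L 'b) \<times> ('a \<Rightarrow>\<^sub>C\<^sub>L 'b)) filter) =
      (INF e\<in>{0 <..}. principal {(x, y). dist x y < e})"
    by (rule uniformity_cblinfun_def)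
  show "open S = (\<forall>x\<in>S. \<forall>\<^sub>F (x', y) in uniformity. x' = x \<longrightarrow> y \<in> S)"
    by (rule open_cblinfun_def)
  show "sgn f = scaleR (inverse (norm f)) f"
    by (rule sgn_cblinfun_def)
  show "f + g + h = f + (g + h)" by transfer (simp add: add.assoc)
  show "f + g = g + f" by transfer (simp add: add.commute)
  show "0 + f = f" by transfer simp
  show "- f + f = 0" by transfer simp
  show "f - g = f + - g" by transfer simp
  show "r *\<^sub>R (f + g) = r *\<^sub>R f + r *\<^sub>R g" by transfer (simp add: scaleR_add_right)
  show "(r + s) *\<^sub>R f = r *\<^sub>R f + s *\<^sub>R f" by transfer (simp add: scaleR_add_left)
  show "r *\<^sub>R s *\<^sub>R f = (r * s) *\<^sub>R f" by transfer simp
  show "1 *\<^sub>R f = f" by transfer simp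
  show "a *\<^sub>C (f + g) = a *\<^sub>C f + a *\<^sub>C g" by transfer (simp add: scaleC_add_right)
  show "(a + b) *\<^sub>C f = a *\<^sub>C f + b *\<^sub>C f" by transfer (simp add: scaleC_add_left)
  show "a *\<^sub>C b *\<^sub>C f = (a * b) *\<^sub>C f" by transfer (simp add: scaleC_scaleC)
  show "1 *\<^sub>C f = f" by transfer (simp add: scaleC_one)
  show "r *\<^sub>R f = complex_of_real r *\<^sub>C f" by transfer (simp add: scaleR_scaleC)
  show "norm f = 0 \<longleftrightarrow> f = 0"
    by transfer (simp add: onorm_eq_0 bounded_clinear_bounded_linear fun_eq_iff)
  show "norm (f + g) \<le> norm f + norm g"
    by transfer (simp add: onorm_triangle bounded_clinear_bounded_linear)
  show "norm (r *\<^sub>R f) = \<bar>r\<bar> * norm f"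
    by transfer (simp add: onorm_scaleR bounded_clinear_bounded_linear)
  show "norm (a *\<^sub>C f) = cmod a * norm f"
    by transfer (simp add: onorm_scaleC)
qed

end

lift_definition cblinfun_compose ::
  "('b::complex_normed_vector \<Rightarrow>\<^sub>C\<^sub>L 'c::complex_normed_vector) \<Rightarrow>
    ('a::complex_normed_vector \<Rightarrow>\<^sub>C\<^sub>L 'b) \<Rightarrow> ('a \<Rightarrow>\<^sub>C\<^sub>L 'c)" (infixl \<open>o\<^sub>C\<close> 67)
  is "\<lambda>f g x. f (g x)"
  by (rule bounded_clinear_compose)

type_synonym 'a cdual = "'a \<Rightarrow>\<^sub>C\<^sub>L complex"

lemma norm_cblinfun: "norm (cblinfun_apply f x) \<le> norm f * norm x"
  by transfer (simp add: onorm bounded_clinear_bounded_linear)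

lemma norm_cblinfun_compose: "norm (f o\<^sub>C g) \<le> norm f * norm g"
  by transfer
    (use onorm_compose in \<open>force simp: bounded_clinear_bounded_linear comp_def\<close>)

lift_definition cadjoint ::
  "('a::complex_normed_vector \<Rightarrow>\<^sub>C\<^sub>L 'b::complex_normed_vector) \<Rightarrow> ('b cdual \<Rightarrow>\<^sub>C\<^sub>L 'a cdual)"
  is "\<lambda>T f. f o\<^sub>C T"
proof -
  fix T :: "'a \<Rightarrow>\<^sub>C\<^sub>L 'b"
  have "bounded_linear (\<lambda>f :: 'b cdual. f o\<^sub>C T)"
  proof (rule bounded_linear_intro[where K = "norm T"])
    show "(f + g) o\<^sub>C T = f o\<^sub>C T + g o\<^sub>C T" for f g :: "'b cdual"
      by transfer simp
    show "(r *\<^sub>R f) o\<^sub>C T = r *\<^sub>R (f o\<^sub>C T)" for r and f :: "'b cdual"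
      by transfer simp
    show "norm (f o\<^sub>C T) \<le> norm f * norm T" for f :: "'b cdual"
      by (rule norm_cblinfun_compose)
  qed
  moreover have "(c *\<^sub>C f) o\<^sub>C T = c *\<^sub>C (f o\<^sub>C T)" for c and f :: "'b cdual"
    by transfer simp
  ultimately show "bounded_clinear (\<lambda>f :: 'b cdual. f o\<^sub>C T)"
    by (simp add: bounded_clinear_def)
qed

lemma cadjoint_apply:
  "cblinfun_apply (cblinfun_apply (cadjoint T) f) x = cblinfun_apply f (cblinfun_apply T x)"
  by (simp add: cadjoint.rep_eq cblinfun_compose.rep_eq)


section \<open>Approximation numbers, compactness and weak operator convergence\<close>

definition finite_rank_less ::
  "nat \<Rightarrow> ('a::complex_normed_vector \<Rightarrow>\<^sub>C\<^sub>L 'b::complex_normed_vector) set"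
  where "finite_rank_less k =
    {F. finite_cdim (range (cblinfun_apply F)) \<and> cdim (range (cblinfun_apply F)) < k}"

text \<open>Only indices \<open>k \<ge> 1\<close> are meaningful: for \<open>k = 0\<close> the infimum is over the empty set.\<close>

definition approx_number ::
  "nat \<Rightarrow> ('a::complex_normed_vector \<Rightarrow>\<^sub>C\<^sub>L 'b::complex_normed_vector) \<Rightarrow> real"
  where "approx_number k T = (INF F\<in>finite_rank_less k. norm (T - F))"

text \<open>The spaces need not be complete, so relative compactness (compact closure in the
  codomain) is not the same as total boundedness.\<close>

definition compact_operator ::
  "('a::complex_normed_vector \<Rightarrow>\<^sub>C\<^sub>L 'b::complex_normed_vector) \<Rightarrow> bool"
  where "compact_operator T \<longleftrightarrow> (\<forall>S. bounded S \<longrightarrow> compact (closure (cblinfun_apply T ` S)))"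

definition weak_operator_tendsto ::
  "(nat \<Rightarrow> ('a::complex_normed_vector \<Rightarrow>\<^sub>C\<^sub>L 'b::complex_normed_vector)) \<Rightarrow> ('a \<Rightarrow>\<^sub>C\<^sub>L 'b) \<Rightarrow> bool"
  where "weak_operator_tendsto S T \<longleftrightarrow>
    (\<forall>(f :: 'b cdual) x. (\<lambda>n. cmod (f (S n x) - f (T x))) \<longlonglongrightarrow> 0)"

lemma approx_number_bounds:
  assumes "k \<ge> 1"
  shows "0 \<le> approx_number k T" "approx_number k T \<le> norm T"
proof -
  have "range (cblinfun_apply (0 :: 'a \<Rightarrow>\<^sub>C\<^sub>L 'b)) = {0}"
    by (auto simp: zero_cblinfun.rep_eq)
  moreover have "cdim {0 :: 'b} = 0"
    using complex_vector.dim_le_card[of "{0}" "{}"] by simp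
  moreover have "finite_cdim {0 :: 'b}"
    unfolding finite_cdim_def by (rule exI[of _ "{}"]) simp
  ultimately have zero: "(0 :: 'a \<Rightarrow>\<^sub>C\<^sub>L 'b) \<in> finite_rank_less k"
    using assms by (simp add: finite_rank_less_def)
  show "0 \<le> approx_number k T"
    unfolding approx_number_def using zero by (intro cINF_greatest) auto
  have "approx_number k T \<le> norm (T - 0)"
    unfolding approx_number_def using zero by (intro cINF_lower bdd_belowI2[where m = 0]) auto
  then show "approx_number k T \<le> norm T" by simp
qed

end

theory Submission
  imports Defs "HOL-Library.Function_Algebras"
begin

text \<open>
  The numbers \<open>a\<^sub>k(T\<^sub>n)\<close> always converge to \<open>a\<^sub>k(T')\<close>, so the equivalence is just uniqueness
  of limits.

  Upper bound: \<open>a\<^sub>k(S) \<le> a\<^sub>k(S')\<close> for compact \<open>S\<close> (Hutton), and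
  \<open>T\<^sub>n' = P\<^sub>n' T' Q\<^sub>n'\<close>, hence \<open>a\<^sub>k(T\<^sub>n) \<le> a\<^sub>k(T\<^sub>n') \<le> a\<^sub>k(T')\<close>.
  For Hutton's inequality write an operator \<open>H : Y' \<rightarrow> X'\<close> of rank \<open>r < k\<close> as
  \<open>\<Sum>j. \<phi>\<^sub>j \<otimes> h\<^sub>j\<close> with \<open>\<phi>\<^sub>j \<in> Y''\<close>. By compactness, the inequality
  \<open>\<parallel>S x - \<Sum>j. h\<^sub>j(x) y\<^sub>j\<parallel> \<le> c\<close> has to hold for finitely many \<open>x\<close> in the unit ball only,
  and a finite system of such inequalities that the \<open>\<phi>\<^sub>j\<close> satisfy in \<open>Y''\<close> is solvable
  in \<open>Y\<close> with arbitrarily small loss, by Hahn--Banach. This replaces local reflexivity.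

  Lower bound: if \<open>\<parallel>T\<^sub>n - R\<^sub>n\<parallel> \<le> L\<close> frequently, with \<open>R\<^sub>n\<close> of rank less than \<open>k\<close>, then by
  Tychonoff's theorem the bounded bilinear forms \<open>f(R\<^sub>n x)\<close> have a pointwise limit along a finer
  filter. The limit is an operator \<open>H : Y' \<rightarrow> X'\<close> with \<open>\<parallel>T' - H\<parallel> \<le> L\<close>, and its rank is
  less than \<open>k\<close>: otherwise some \<open>k \<times> k\<close> matrix \<open>f\<^sub>i(R\<^sub>n x\<^sub>j)\<close> would be close to the identity.
\<close>

section \<open>The Mazur--Orlicz form of the Hahn--Banach theorem\<close>

text \<open>Only the inequality for positive \<open>t\<close> is demanded: applied to
  \<open>inverse t\<close> it gives equality, and \<open>p 0 = 0\<close> follows from both clauses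
  together.\<close>

definition sublinear :: "('a::real_vector \<Rightarrow> real) \<Rightarrow> bool"
  where "sublinear p \<longleftrightarrow> (\<forall>x y. p (x + y) \<le> p x + p y) \<and> (\<forall>t x. 0 < t \<longrightarrow> p (t *\<^sub>R x) \<le> t * p x)"

lemma sublinear_add: "sublinear p \<Longrightarrow> p (x + y) \<le> p x + p y"
  by (simp add: sublinear_def)

lemma sublinear_zero:
  assumes "sublinear p"
  shows "p 0 = 0"
proof -
  have "p ((1 / 2) *\<^sub>R 0) \<le> 1 / 2 * p 0"
    using assms unfolding sublinear_def by (metis half_gt_zero zero_less_one)
  then show ?thesis
    using sublinear_add[OF assms, of 0 0] by simp
qed

lemma sublinear_scaleR:
  assumes "sublinear p" "0 \<le> t"
  shows "p (t *\<^sub>R x) = t * p x"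
proof (cases "t = 0")
  case True
  then show ?thesis by (simp add: sublinear_zero[OF assms(1)])
next
  case False
  with assms(2) have t: "0 < t" by simp
  have "p (inverse t *\<^sub>R t *\<^sub>R x) \<le> inverse t * p (t *\<^sub>R x)"
    using assms(1) t unfolding sublinear_def by (meson positive_imp_inverse_positive)
  then have "t * p x \<le> p (t *\<^sub>R x)"
    using t by (simp add: field_simps)
  moreover have "p (t *\<^sub>R x) \<le> t * p x"
    using assms(1) t unfolding sublinear_def by blast
  ultimately show ?thesis by simp
qed

lemma sublinear_minus_le: "sublinear p \<Longrightarrow> - p (- x) \<le> p x"
  using sublinear_add[of p x "- x"] by (simp add: sublinear_zero)

text \<open>Take the infimum of \<open>p (x + t *\<^sub>R c) - t * \<beta>\<close> over
  \<open>t \<ge> 0\<close> and \<open>c \<in> C\<close>, which is the largest candidate. The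
  hypothesis \<open>\<beta> \<le> p c\<close> bounds it below by \<open>- p (- x)\<close>, and
  convexity of \<open>C\<close> makes it subadditive.\<close>

lemma sublinear_decrease:
  assumes p: "sublinear p" and C: "convex C" "C \<noteq> {}" and \<beta>: "\<And>c. c \<in> C \<Longrightarrow> \<beta> \<le> p c"
  obtains q where "sublinear q" "\<And>x. q x \<le> p x" "\<And>c. c \<in> C \<Longrightarrow> q (- c) \<le> - \<beta>"
proof
  define E where "E x = (\<lambda>(t, c). p (x + t *\<^sub>R c) - t * \<beta>) ` ({0..} \<times> C)" for x
  define q where "q x = Inf (E x)" for x
  have EI: "p (x + t *\<^sub>R c) - t * \<beta> \<in> E x" if "0 \<le> t" "c \<in> C" for t c x
    using that unfolding E_def by force
  have ne: "E x \<noteq> {}" for x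
    using C(2) unfolding E_def by auto
  have "- p (- x) \<le> p (x + t *\<^sub>R c) - t * \<beta>" if "0 \<le> t" "c \<in> C" for t c x
  proof -
    have "t * \<beta> \<le> p (t *\<^sub>R c)"
      using that \<beta> by (simp add: sublinear_scaleR[OF p] mult_left_mono)
    also have "\<dots> \<le> p (x + t *\<^sub>R c) + p (- x)"
      using sublinear_add[OF p, of "x + t *\<^sub>R c" "- x"] by simp
    finally show ?thesis by simp
  qed
  then have bdd: "bdd_below (E x)" for x
    unfolding E_def by (intro bdd_belowI[where m = "- p (- x)"]) auto
  have lower: "q x \<le> p (x + t *\<^sub>R c) - t * \<beta>" if "0 \<le> t" "c \<in> C" for t c x
    unfolding q_def using EI[OF that] bdd by (rule cInf_lower)
  have greatest: "m \<le> q x" if "\<And>t c. 0 \<le> t \<Longrightarrow> c \<in> C \<Longrightarrow> m \<le> p (x + t *\<^sub>R c) - t * \<beta>" for m x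
    unfolding q_def using ne that by (intro cInf_greatest) (auto simp: E_def)
  obtain c0 where c0: "c0 \<in> C" using C(2) by auto
  show "q x \<le> p x" for x
    using lower[of 0 c0 x] c0 by simp
  show "q (- c) \<le> - \<beta>" if "c \<in> C" for c
    using lower[of 1 c "- c"] that by (simp add: sublinear_zero[OF p])
  show "sublinear q"
    unfolding sublinear_def
  proof (intro conjI allI impI)
    fix x y
    have *: "q (x + y) \<le> (p (x + t *\<^sub>R c) - t * \<beta>) + (p (y + s *\<^sub>R d) - s * \<beta>)"
      if "0 \<le> t" "c \<in> C" "0 \<le> s" "d \<in> C" for t c s d
    proof (cases "t + s = 0")
      case True
      with that have "t = 0" "s = 0" by auto
      then show ?thesis
        using lower[of 0 c "x + y"] that sublinear_add[OF p, of x y] by simp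
    next
      case False
      \<comment> \<open>Two shifts \<open>t *\<^sub>R c\<close> and \<open>s *\<^sub>R d\<close>
        merge into a single shift: \<open>t + s\<close> times a convex combination.\<close>
      define e where "e = (t / (t + s)) *\<^sub>R c + (s / (t + s)) *\<^sub>R d"
      have "e \<in> C"
        unfolding e_def using that False
        by (intro convexD[OF C(1)]) (auto simp: add_divide_distrib[symmetric])
      moreover have "(t + s) *\<^sub>R e = t *\<^sub>R c + s *\<^sub>R d"
        using False by (simp add: e_def scaleR_add_right)
      ultimately have "q (x + y) \<le> p ((x + t *\<^sub>R c) + (y + s *\<^sub>R d)) - (t + s) * \<beta>"
        using lower[of "t + s" e "x + y"] that by (simp add: algebra_simps)
      also have "\<dots> \<le> p (x + t *\<^sub>R c) + p (y + s *\<^sub>R d) - (t + s) * \<beta>"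
        using sublinear_add[OF p] by simp
      finally show ?thesis by (simp add: algebra_simps)
    qed
    have "q (x + y) - (p (x + t *\<^sub>R c) - t * \<beta>) \<le> q y" if "0 \<le> t" "c \<in> C" for t c
      using *[OF that] by (intro greatest) (simp add: algebra_simps)
    then have "q (x + y) - q y \<le> q x"
      by (intro greatest) (simp add: algebra_simps)
    then show "q (x + y) \<le> q x + q y" by simp
  next
    fix r :: real and x assume r: "0 < r"
    have "q (r *\<^sub>R x) / r \<le> q x"
    proof (rule greatest)
      fix t :: real and c assume "0 \<le> t" "c \<in> C"
      then have "q (r *\<^sub>R x) \<le> p (r *\<^sub>R (x + t *\<^sub>R c)) - r * t * \<beta>"
        using lower[of "r * t" c "r *\<^sub>R x"] r by (simp add: scaleR_add_right)
      also have "\<dots> = r * (p (x + t *\<^sub>R c) - t * \<beta>)"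
        using r sublinear_scaleR[OF p, of r "x + t *\<^sub>R c"] by (simp add: algebra_simps)
      finally show "q (r *\<^sub>R x) / r \<le> p (x + t *\<^sub>R c) - t * \<beta>"
        using r by (simp add: field_simps)
    qed
    then show "q (r *\<^sub>R x) \<le> r * q x"
      using r by (simp add: field_simps)
  qed
qed

text \<open>Zorn's lemma for the sublinear functionals below \<open>p\<close>: a chain has its
  pointwise infimum as lower bound, finite because every member satisfies
  \<open>- p (- x) \<le> q x\<close>.\<close>

lemma minimal_sublinear:
  assumes p: "sublinear p"
  obtains q where "sublinear q" "q \<le> p" "\<And>r. sublinear r \<Longrightarrow> r \<le> q \<Longrightarrow> r = q"
proof -
  define A where "A = {q. sublinear q \<and> q \<le> p}"
  \<comment> \<open>The order is reversed, so that a maximal element for Zorn is a minimal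
    functional.\<close>
  define R where "R = relation_of (\<lambda>q r. r \<le> q) A"
  have "partial_order_on A R"
    unfolding R_def by (rule partial_order_on_relation_ofI) auto
  moreover have "\<exists>u\<in>A. \<forall>q\<in>C. u \<le> q" if C: "C \<in> Chains R" for C
  proof (cases "C = {}")
    case True
    then show ?thesis using p unfolding A_def by auto
  next
    case False
    have CA: "sublinear q" "q \<le> p" if "q \<in> C" for q
      using C that unfolding R_def Chains_def relation_of_def A_def by auto
    have total: "q \<le> r \<or> r \<le> q" if "q \<in> C" "r \<in> C" for q r
      using C that unfolding R_def Chains_def relation_of_def by auto
    have "- p (- x) \<le> q x" if "q \<in> C" for q x
      using sublinear_minus_le[OF CA(1)[OF that], of x] CA(2)[OF that]
      by (smt (verit) le_fun_def)
    then have bdd: "bdd_below ((\<lambda>q. q x) ` C)" for x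
      by (intro bdd_belowI2)
    define u where "u x = (INF q\<in>C. q x)" for x
    have lower: "u x \<le> q x" if "q \<in> C" for q x
      unfolding u_def using bdd that by (rule cINF_lower)
    have greatest: "m \<le> u x" if "\<And>q. q \<in> C \<Longrightarrow> m \<le> q x" for m x
      unfolding u_def using False that by (rule cINF_greatest)
    have "sublinear u"
      unfolding sublinear_def
    proof (intro conjI allI impI)
      fix x y
      \<comment> \<open>In a chain the smaller of \<open>q\<close> and \<open>r\<close> lies below
        both, so different members may bound the two summands.\<close>
      have *: "u (x + y) \<le> q x + r y" if qr: "q \<in> C" "r \<in> C" for q r
      proof -
        obtain s where s: "s \<in> C" "s \<le> q" "s \<le> r"
          using total[OF qr] qr by blast
        have "u (x + y) \<le> s x + s y"
          using lower[OF s(1)] sublinear_add[OF CA(1)[OF s(1)]] by (meson order_trans)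
        also have "\<dots> \<le> q x + r y"
          using s by (simp add: add_mono le_funD)
        finally show ?thesis .
      qed
      have "u (x + y) - q x \<le> u y" if "q \<in> C" for q
        using *[OF that] by (intro greatest) (simp add: algebra_simps)
      then have "u (x + y) - u y \<le> u x"
        by (intro greatest) (simp add: algebra_simps)
      then show "u (x + y) \<le> u x + u y" by simp
    next
      fix t :: real and x assume t: "0 < t"
      have "u (t *\<^sub>R x) / t \<le> u x"
      proof (rule greatest)
        fix q assume q: "q \<in> C"
        have "u (t *\<^sub>R x) \<le> t * q x"
          using lower[OF q, of "t *\<^sub>R x"] t by (simp add: sublinear_scaleR[OF CA(1)[OF q]])
        then show "u (t *\<^sub>R x) / t \<le> q x" using t by (simp add: field_simps)
      qed
      then show "u (t *\<^sub>R x) \<le> t * u x"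
        using t by (simp add: field_simps)
    qed
    moreover have "u \<le> p"
      using False lower CA(2) by (metis all_not_in_conv le_funI le_funD order_trans)
    ultimately show ?thesis
      using lower unfolding A_def by (auto intro!: le_funI)
  qed
  ultimately obtain m where "m \<in> A" "\<forall>a\<in>A. a \<le> m \<longrightarrow> a = m"
    unfolding R_def using predicate_Zorn[of A "\<lambda>q r. r \<le> q"] by blast
  with that show thesis unfolding A_def by (metis (mono_tags, lifting) mem_Collect_eq order_trans)
qed

text \<open>\<open>sublinear_decrease\<close> turns the lower bound on \<open>C\<close> into an
  upper bound on the negatives of its points, which every smaller functional inherits. A minimal one
  is linear, and \<open>f c = - f (- c)\<close> restores the lower bound.\<close>

theorem Mazur_Orlicz:
  assumes p: "sublinear p" and C: "convex C" "C \<noteq> {}" and \<beta>: "\<And>c. c \<in> C \<Longrightarrow> \<beta> \<le> p c"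
  obtains f where "linear f" "\<And>x. f x \<le> p x" "\<And>c. c \<in> C \<Longrightarrow> \<beta> \<le> f c"
proof -
  obtain p' where p': "sublinear p'" "\<And>x. p' x \<le> p x" "\<And>c. c \<in> C \<Longrightarrow> p' (- c) \<le> - \<beta>"
    using sublinear_decrease[OF assms] by blast
  obtain f where f: "sublinear f" "f \<le> p'" and min: "\<And>r. sublinear r \<Longrightarrow> r \<le> f \<Longrightarrow> r = f"
    using minimal_sublinear[OF p'(1)] by blast
  \<comment> \<open>a minimal \<open>f\<close> is left unchanged by \<open>sublinear_decrease\<close> at the singleton \<open>{y}\<close>\<close>
  have add: "f (x + y) = f x + f y" for x y
  proof (rule antisym[OF sublinear_add[OF f(1)]])
    obtain r where r: "sublinear r" "\<And>z. r z \<le> f z" "r (- y) \<le> - f y"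
      using sublinear_decrease[OF f(1), of "{y}" "f y"] by (metis convex_singleton insert_not_empty singletonD singletonI order_refl)
    then have "r = f" using min by (simp add: le_funI)
    then have "f (- y) \<le> - f y" using r(3) by simp
    then show "f x + f y \<le> f (x + y)"
      using sublinear_add[OF f(1), of "x + y" "- y"] by simp
  qed
  then have neg: "f (- x) = - f x" for x
    using add[of x "- x"] sublinear_zero[OF f(1)] by simp
  have "f (t *\<^sub>R x) = t *\<^sub>R f x" for t :: real and x
  proof (cases "0 \<le> t")
    case False
    then show ?thesis
      using sublinear_scaleR[OF f(1), of "- t" x] neg[of "t *\<^sub>R x"] by simp
  qed (simp add: sublinear_scaleR[OF f(1)])
  with add have "linear f" by (rule linearI)
  moreover have "f x \<le> p x" for x
    using f(2) p'(2) by (meson le_fun_def order_trans)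
  moreover have "\<beta> \<le> f c" if "c \<in> C" for c
    using p'(3)[OF that] f(2) neg[of c] by (smt (verit) le_fun_def)
  ultimately show thesis by (rule that)
qed

section \<open>A Helly type theorem for the bidual\<close>

text \<open>Families indexed by \<open>'i\<close> have to form a real vector space for
  \<open>Mazur_Orlicz\<close> to apply to them in \<open>Helly_bidual\<close>.\<close>

instantiation "fun" :: (type, real_vector) real_vector
begin

definition scaleR_fun :: "real \<Rightarrow> ('a \<Rightarrow> 'b) \<Rightarrow> 'a \<Rightarrow> 'b"
  where "scaleR_fun r f = (\<lambda>x. r *\<^sub>R f x)"

instance
  by standard (simp_all add: scaleR_fun_def fun_eq_iff scaleR_add_right scaleR_add_left)

end

lemma sum_fun_apply: "(\<Sum>i\<in>I. F i) x = (\<Sum>i\<in>I. F i x)"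
  by (induction I rule: infinite_finite_induct) auto

section \<open>Evaluation rules for bounded complex-linear operators\<close>

lemma bounded_clinear_cblinfun: "bounded_clinear (cblinfun_apply f)"
  using cblinfun_apply by auto

lemma cblinfun_add_right: "cblinfun_apply f (x + y) = f x + f y"
  using linear_add[OF bounded_linear.linear[OF bounded_clinear_bounded_linear[OF bounded_clinear_cblinfun]]] .

lemma cblinfun_zero_right [simp]: "cblinfun_apply f 0 = 0"
  using linear_0[OF bounded_linear.linear[OF bounded_clinear_bounded_linear[OF bounded_clinear_cblinfun]]] .

lemma cblinfun_diff_right: "cblinfun_apply f (x - y) = f x - f y"
  using linear_diff[OF bounded_linear.linear[OF bounded_clinear_bounded_linear[OF bounded_clinear_cblinfun]]] .

lemma cblinfun_scaleC_right: "cblinfun_apply f (c *\<^sub>C x) = c *\<^sub>C f x"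
  using bounded_clinear_cblinfun[of f] by (simp add: bounded_clinear_def)

lemma cblinfun_sum_right: "cblinfun_apply f (\<Sum>i\<in>I. x i) = (\<Sum>i\<in>I. cblinfun_apply f (x i))"
  by (induction I rule: infinite_finite_induct) (simp_all add: cblinfun_add_right)

lemma cblinfun_sum_left: "cblinfun_apply (\<Sum>i\<in>I. F i) x = (\<Sum>i\<in>I. cblinfun_apply (F i) x)"
  by (induction I rule: infinite_finite_induct)
    (simp_all add: zero_cblinfun.rep_eq plus_cblinfun.rep_eq)

lemma cblinfun_eqI: "(\<And>x. cblinfun_apply f x = cblinfun_apply g x) \<Longrightarrow> f = g"
  by (simp add: cblinfun_apply_inject[symmetric] fun_eq_iff)

lemma norm_cblinfun_bound:
  "0 \<le> K \<Longrightarrow> (\<And>x. norm (cblinfun_apply f x) \<le> K * norm x) \<Longrightarrow> norm f \<le> K"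
  by transfer (rule onorm_bound)

lemma bounded_clinear_intro:
  assumes "\<And>x y. f (x + y) = f x + f y" "\<And>c x. f (c *\<^sub>C x) = c *\<^sub>C f x"
    and "\<And>x. norm (f x) \<le> K * norm x"
  shows "bounded_clinear f"
  using assms unfolding bounded_clinear_def
  by (auto intro!: bounded_linear_intro[where K = K] simp: scaleR_scaleC mult.commute)

section \<open>Complex functionals and their real parts\<close>

lemma scaleC_complex [simp]: "c *\<^sub>C (z :: complex) = c * z"
  by (simp add: scaleC_complex_def)

text \<open>The classical choice is r(x) - i r(ix). The bound on \<open>r\<close> becomes two-sided
  by passing to \<open>- x\<close>.\<close>

lemma complexify_functional:
  fixes r :: "'y::complex_normed_vector \<Rightarrow> real"
  assumes r: "linear r" and bound: "\<And>x. r x \<le> K * norm x"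
  obtains g :: "'y cdual" where "\<And>x. Re (g x) = r x"
proof
  define g where "g x = Complex (r x) (- r (\<i> *\<^sub>C x))" for x
  have abs: "\<bar>r x\<bar> \<le> K * norm x" for x
    using bound[of x] bound[of "- x"] by (simp add: linear_neg[OF r])
  have scale: "r (c *\<^sub>C x) = Re c * r x + Im c * r (\<i> *\<^sub>C x)" for c x
  proof -
    have "c *\<^sub>C x = complex_of_real (Re c) *\<^sub>C x + complex_of_real (Im c) *\<^sub>C \<i> *\<^sub>C x"
      by (simp only: scaleC_scaleC scaleC_add_left[symmetric]) (simp add: complex_eq mult.commute)
    then have "c *\<^sub>C x = Re c *\<^sub>R x + Im c *\<^sub>R \<i> *\<^sub>C x"
      by (simp add: scaleR_scaleC)
    then show ?thesis
      by (simp add: linear_add[OF r] linear_scale[OF r])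
  qed
  have "bounded_clinear g"
  proof (rule bounded_clinear_intro)
    show "g (x + y) = g x + g y" for x y
      by (simp add: g_def scaleC_add_right linear_add[OF r] complex_eq_iff)
    show "g (c *\<^sub>C x) = c *\<^sub>C g x" for c x
      using scale[of c x] scale[of "\<i> * c" x]
      by (simp add: g_def scaleC_scaleC complex_eq_iff)
    show "norm (g x) \<le> (2 * K) * norm x" for x
      using cmod_le[of "g x"] abs[of x] abs[of "\<i> *\<^sub>C x"] by (simp add: g_def norm_scaleC)
  qed
  then show "Re (cblinfun_apply (CBlinfun g) x) = r x" for x
    by (simp add: CBlinfun_inverse g_def)
qed

text \<open>A scalar of modulus \<open>1 / norm x\<close> that rotates \<open>g x\<close> onto the
  positive axis moves \<open>x\<close> into the unit ball, where the real part becomes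
  \<open>cmod (g x) / norm x\<close>.\<close>

lemma norm_cdual_le_Re:
  fixes g :: "'y::complex_normed_vector cdual"
  assumes K: "0 \<le> K" and bound: "\<And>x. norm x \<le> 1 \<Longrightarrow> Re (g x) \<le> K"
  shows "norm g \<le> K"
proof (rule norm_cblinfun_bound[OF K])
  fix x
  show "norm (g x) \<le> K * norm x"
  proof (cases "x = 0 \<or> g x = 0")
    case True
    then show ?thesis using K by auto
  next
    case False
    define c where "c = cnj (g x) / (cmod (g x) * norm x)"
    have "c * g x = complex_of_real (cmod (g x) / norm x)"
      using False complex_norm_square[of "g x"]
      by (simp add: c_def field_simps power2_eq_square)
    moreover have "norm (c *\<^sub>C x) \<le> 1"
      using False by (simp add: norm_scaleC c_def norm_divide norm_mult)
    ultimately have "cmod (g x) / norm x \<le> K"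
      using bound[of "c *\<^sub>C x"] by (simp add: cblinfun_scaleC_right)
    then show ?thesis using False by (simp add: field_simps)
  qed
qed

text \<open>A functional on \<open>Y\<^sup>I\<close> separating the affine space of all
  \<open>b - (\<Sum>j. a\<^sub>i\<^sub>j y\<^sub>j)\<^sub>i\<close> from the product of the balls of radius \<open>c\<^sub>i\<close> is constant
  on that space; hence it takes the same value at the \<open>\<phi>\<^sub>j\<close> as at the \<open>y\<^sub>j\<close>.\<close>

theorem Helly_bidual:
  fixes b :: "'i \<Rightarrow> 'y::complex_normed_vector" and \<phi> :: "nat \<Rightarrow> 'y cdual cdual"
  assumes I: "finite I" and d: "\<And>i. i \<in> I \<Longrightarrow> 0 \<le> d i" "\<And>i. i \<in> I \<Longrightarrow> d i < c i"
    and \<phi>: "\<And>i g. i \<in> I \<Longrightarrow> cmod (cblinfun_apply g (b i) - (\<Sum>j<r. a i j * \<phi> j g)) \<le> d i * norm g"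
  obtains y where "\<And>i. i \<in> I \<Longrightarrow> norm (b i - (\<Sum>j<r. a i j *\<^sub>C y j)) < c i"
proof (rule ccontr)
  assume "\<not> thesis"
  then have no: "\<exists>i\<in>I. c i \<le> norm (b i - (\<Sum>j<r. a i j *\<^sub>C y j))" for y
    using that by (meson not_le)
  then have ne: "I \<noteq> {}" by auto
  have c: "0 < c i" if "i \<in> I" for i
    using d[OF that] by linarith
  \<comment> \<open>\<open>q\<close> is the gauge of the product of the balls of radius
    \<open>c i\<close>; it sees only the coordinates in \<open>I\<close>. The negated conclusion
    says that \<open>q\<close> is at least 1 at every \<open>b - A y\<close>.\<close>
  define q where "q z = Max ((\<lambda>i. norm (z i) / c i) ` I)" for z :: "'i \<Rightarrow> 'y"
  define A where "A y = (\<lambda>i. \<Sum>j<r. a i j *\<^sub>C y j)" for y :: "nat \<Rightarrow> 'y"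
  have q_ge: "norm (z i) / c i \<le> q z" if "i \<in> I" for z i
    unfolding q_def using I that by (intro Max_ge) auto
  have q_le: "q z \<le> m" if "\<And>i. i \<in> I \<Longrightarrow> norm (z i) / c i \<le> m" for z m
    unfolding q_def using I ne that by (subst Max_le_iff) auto
  have "sublinear q"
    unfolding sublinear_def
  proof (intro conjI allI impI)
    show "q (x + z) \<le> q x + q z" for x z
    proof (rule q_le)
      fix i assume i: "i \<in> I"
      have "norm ((x + z) i) / c i \<le> norm (x i) / c i + norm (z i) / c i"
        using c[OF i] norm_triangle_ineq[of "x i" "z i"]
        by (simp add: add_divide_distrib[symmetric] divide_right_mono)
      also have "\<dots> \<le> q x + q z"
        using q_ge[OF i] by (intro add_mono)
      finally show "norm ((x + z) i) / c i \<le> q x + q z" .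
    qed
    show "q (t *\<^sub>R z) \<le> t * q z" if "0 < t" for t :: real and z
    proof (rule q_le)
      fix i assume "i \<in> I"
      then show "norm ((t *\<^sub>R z) i) / c i \<le> t * q z"
        using mult_left_mono[OF q_ge[of i z], of t] that by (simp add: scaleR_fun_def)
    qed
  qed
  moreover have "convex (range (\<lambda>y. b - A y))"
  proof (rule convexI)
    fix x z and u v :: real
    assume "x \<in> range (\<lambda>y. b - A y)" "z \<in> range (\<lambda>y. b - A y)" and uv: "u + v = 1"
    then obtain y y' where xz: "x = b - A y" "z = b - A y'" by auto
    have "u *\<^sub>R A y + v *\<^sub>R A y' = A (u *\<^sub>R y + v *\<^sub>R y')"
      by (simp add: A_def scaleR_fun_def fun_eq_iff sum.distrib scaleC_add_right
          scaleR_scaleC scaleC_scaleC complex_vector.scale_sum_right mult.commute)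
    moreover have "u *\<^sub>R b + v *\<^sub>R b = b"
      using uv by (simp add: scaleR_add_left[symmetric])
    ultimately have "u *\<^sub>R x + v *\<^sub>R z = b - A (u *\<^sub>R y + v *\<^sub>R y')"
      unfolding xz by (simp add: scaleR_diff_right algebra_simps)
    then show "u *\<^sub>R x + v *\<^sub>R z \<in> range (\<lambda>y. b - A y)" by auto
  qed
  moreover have "1 \<le> q z" if z: "z \<in> range (\<lambda>y. b - A y)" for z
  proof -
    obtain y where y: "z = b - A y" using z by auto
    obtain i where i: "i \<in> I" "c i \<le> norm (z i)"
      using no[of y] unfolding y by (auto simp: A_def)
    then have "1 \<le> norm (z i) / c i" using c by (simp add: field_simps)
    also have "\<dots> \<le> q z" by (rule q_ge[OF i(1)])
    finally show ?thesis .
  qed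
  ultimately obtain f where f: "linear f" and fq: "\<And>z. f z \<le> q z"
    and f1: "\<And>z. z \<in> range (\<lambda>y. b - A y) \<Longrightarrow> 1 \<le> f z"
    using Mazur_Orlicz[of q "range (\<lambda>y. b - A y)" 1] by blast

  define e where "e i v = (\<lambda>k. if k = i then v else 0)" for i :: 'i and v :: 'y
  have "\<exists>g :: 'y cdual. \<forall>v. Re (g v) = f (e i v)" if i: "i \<in> I" for i
  proof -
    have "linear (\<lambda>v. f (e i v))"
    proof (rule linearI)
      have "e i (x + y) = e i x + e i y" for x y by (simp add: e_def fun_eq_iff)
      then show "f (e i (x + y)) = f (e i x) + f (e i y)" for x y
        by (simp add: linear_add[OF f])
      have "e i (t *\<^sub>R x) = t *\<^sub>R e i x" for t :: real and x by (simp add: e_def fun_eq_iff scaleR_fun_def)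
      then show "f (e i (t *\<^sub>R x)) = t *\<^sub>R f (e i x)" for t x
        by (simp add: linear_scale[OF f])
    qed
    moreover have "f (e i v) \<le> (1 / c i) * norm v" for v
    proof -
      have "q (e i v) \<le> norm v / c i"
        using c by (intro q_le) (auto simp: e_def less_imp_le[OF c[OF i]])
      then show ?thesis using fq[of "e i v"] by simp
    qed
    ultimately show ?thesis
      by (metis complexify_functional)
  qed
  then obtain g :: "'i \<Rightarrow> 'y cdual" where g: "\<And>i v. i \<in> I \<Longrightarrow> Re (g i v) = f (e i v)"
    by metis
  have f_eq: "f z = (\<Sum>i\<in>I. Re (g i (z i)))" for z
  proof -
    \<comment> \<open>\<open>w\<close> agrees with \<open>z\<close> on \<open>I\<close>, so
      \<open>q\<close> vanishes on their difference and \<open>f\<close> takes the same value at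
      both.\<close>
    define w where "w = (\<Sum>i\<in>I. e i (z i))"
    have w: "w i = z i" if "i \<in> I" for i
      using that I by (simp add: w_def sum_fun_apply e_def)
    have "q (z - w) \<le> 0" "q (w - z) \<le> 0"
      by (rule q_le; simp add: w)+
    then have "f z = f w"
      using fq[of "z - w"] fq[of "w - z"] by (simp add: linear_diff[OF f])
    also have "\<dots> = (\<Sum>i\<in>I. Re (g i (z i)))"
      by (simp add: w_def linear_sum[OF f] g)
    finally show ?thesis .
  qed
  have fA: "f (A y) = 0" for y
  proof (rule ccontr)
    assume nz: "f (A y) \<noteq> 0"
    \<comment> \<open>This \<open>t\<close> would make \<open>f\<close> vanish at
      \<open>b - A (t *\<^sub>R y)\<close>, where it is at least 1.\<close>
    define t where "t = f b / f (A y)"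
    have "A (t *\<^sub>R y) = t *\<^sub>R A y"
      by (simp add: A_def scaleR_fun_def fun_eq_iff scaleR_scaleC scaleC_scaleC complex_vector.scale_sum_right mult.commute)
    then have "f (b - A (t *\<^sub>R y)) = 0"
      using nz by (simp add: linear_diff[OF f] linear_scale[OF f] t_def)
    then show False using f1[of "b - A (t *\<^sub>R y)"] by simp
  qed
  then have fb: "1 \<le> f b"
    using f1[of "b - A 0"] by (simp add: linear_diff[OF f])
  have "(\<Sum>i\<in>I. a i j *\<^sub>C g i) = 0" if j: "j < r" for j
  proof (rule cblinfun_eqI)
    fix v
    define s where "s = (\<Sum>i\<in>I. a i j * g i v)"
    \<comment> \<open>Test \<open>fA\<close> on the family whose only nonzero entry is
      \<open>\<gamma> *\<^sub>C v\<close> at \<open>j\<close>; the choices 1 and \<open>\<i>\<close>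
      of \<open>\<gamma>\<close> then kill the real and the imaginary part of
      \<open>s\<close>.\<close>
    have "Re (\<gamma> * s) = 0" for \<gamma>
    proof -
      have "A (\<lambda>k. if k = j then \<gamma> *\<^sub>C v else 0) = (\<lambda>i. a i j *\<^sub>C \<gamma> *\<^sub>C v)"
        using j by (simp add: A_def fun_eq_iff if_distrib cong: if_cong)
      then have "(\<Sum>i\<in>I. Re (g i (a i j *\<^sub>C \<gamma> *\<^sub>C v))) = 0"
        using fA[of "\<lambda>k. if k = j then \<gamma> *\<^sub>C v else 0"] f_eq by simp
      moreover have "g i (a i j *\<^sub>C \<gamma> *\<^sub>C v) = \<gamma> * (a i j * g i v)" for i
        by (simp add: cblinfun_scaleC_right mult.left_commute)
      ultimately have "(\<Sum>i\<in>I. Re (\<gamma> * (a i j * g i v))) = 0" by (simp only:)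
      then show ?thesis
        by (simp only: s_def sum_distrib_left Re_sum)
    qed
    from this[of 1] this[of \<i>] have "s = 0" by (simp add: complex_eq_iff)
    then show "cblinfun_apply (\<Sum>i\<in>I. a i j *\<^sub>C g i) v = cblinfun_apply 0 v"
      by (simp add: cblinfun_sum_left scaleC_cblinfun.rep_eq zero_cblinfun.rep_eq s_def)
  qed
  then have \<phi>0: "(\<Sum>i\<in>I. a i j * \<phi> j (g i)) = 0" if "j < r" for j
    using cblinfun_sum_right[of "\<phi> j" "\<lambda>i. a i j *\<^sub>C g i" I] that by (simp add: cblinfun_scaleC_right)
  \<comment> \<open>The double sum vanishes by \<open>\<phi>0\<close>, so it may be subtracted to
    bring in the hypothesis on the \<open>\<phi> j\<close>.\<close>
  have "f b = Re (\<Sum>i\<in>I. g i (b i) - (\<Sum>j<r. a i j * \<phi> j (g i)))"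
    using sum.swap[of "\<lambda>i j. a i j * \<phi> j (g i)" "{..<r}" I]
    by (simp add: f_eq sum_subtractf \<phi>0)
  also have "\<dots> \<le> (\<Sum>i\<in>I. cmod (g i (b i) - (\<Sum>j<r. a i j * \<phi> j (g i))))"
    by (rule order_trans[OF complex_Re_le_cmod norm_sum])
  also have "\<dots> \<le> (\<Sum>i\<in>I. d i * norm (g i))"
    by (intro sum_mono \<phi>)
  finally have 1: "1 \<le> (\<Sum>i\<in>I. d i * norm (g i))" using fb by simp

  \<comment> \<open>Since \<open>d i < c i\<close>, a unit ball point that nearly attains the norm
    of \<open>g i\<close> already gains strictly, unless \<open>g i = 0\<close>.\<close>
  have "\<exists>u. norm u \<le> 1 \<and> d i * norm (g i) \<le> c i * Re (g i u) \<and>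
      (g i \<noteq> 0 \<longrightarrow> d i * norm (g i) < c i * Re (g i u))" if i: "i \<in> I" for i
  proof (cases "g i = 0")
    case True
    then show ?thesis by (intro exI[of _ 0]) simp
  next
    case False
    have "\<exists>u. norm u \<le> 1 \<and> d i * norm (g i) < c i * Re (g i u)"
    proof (rule ccontr)
      assume *: "\<not> ?thesis"
      have "norm (g i) \<le> d i * norm (g i) / c i"
        using * d[OF i] c[OF i]
        by (intro norm_cdual_le_Re) (auto simp: field_simps not_less)
      then show False using False d[OF i] c[OF i] by (simp add: field_simps)
    qed
    then show ?thesis by (meson less_imp_le)
  qed
  then obtain u where u: "\<And>i. i \<in> I \<Longrightarrow> norm (u i) \<le> 1"
      "\<And>i. i \<in> I \<Longrightarrow> d i * norm (g i) \<le> c i * Re (g i (u i))"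
      "\<And>i. i \<in> I \<Longrightarrow> g i \<noteq> 0 \<Longrightarrow> d i * norm (g i) < c i * Re (g i (u i))"
    by metis
  \<comment> \<open>The family of all \<open>c i *\<^sub>R u i\<close> lies in the unit ball of
    \<open>q\<close>, so \<open>f\<close> is at most 1 there; the strict gain contradicts the lower
    bound 1 for the sum with \<open>d i\<close>.\<close>
  have "(\<Sum>i\<in>I. c i * Re (g i (u i))) = f (\<lambda>i. c i *\<^sub>R u i)"
    by (simp add: f_eq scaleR_scaleC cblinfun_scaleC_right)
  also have "\<dots> \<le> q (\<lambda>i. c i *\<^sub>R u i)" by (rule fq)
  also have "\<dots> \<le> 1"
    using u(1) c by (intro q_le) (auto simp: less_imp_le dest: c)
  finally have le1: "(\<Sum>i\<in>I. c i * Re (g i (u i))) \<le> 1" .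
  have "\<exists>i\<in>I. g i \<noteq> 0"
  proof (rule ccontr)
    assume "\<not> ?thesis"
    then have "(\<Sum>i\<in>I. d i * norm (g i)) = 0" by simp
    with 1 show False by simp
  qed
  then have "(\<Sum>i\<in>I. d i * norm (g i)) < (\<Sum>i\<in>I. c i * Re (g i (u i)))"
    using u by (intro sum_strict_mono_ex1[OF I]) auto
  with 1 le1 show False by simp
qed

section \<open>Finite rank and biorthogonal systems\<close>

text \<open>Trades dimension for a small spanning set, which is easier to transport. Such a set is
  found as a basis of the range, finite because the range is finitely spanned.\<close>

lemma finite_rank_less_iff:
  "F \<in> finite_rank_less k \<longleftrightarrow> (\<exists>B. finite B \<and> card B < k \<and> range (cblinfun_apply F) \<subseteq> cspan B)"
proof
  assume F: "F \<in> finite_rank_less k"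
  obtain B where B: "B \<subseteq> range (cblinfun_apply F)" "\<not> cdependent B"
      "range (cblinfun_apply F) \<subseteq> cspan B" "card B = cdim (range (cblinfun_apply F))"
    using complex_vector.basis_exists by blast
  obtain A where A: "finite A" "range (cblinfun_apply F) \<subseteq> cspan A"
    using F by (auto simp: finite_rank_less_def finite_cdim_def)
  have "finite B"
    using complex_vector.independent_span_bound[OF A(1) B(2)] B(1) A(2) by blast
  with B F show "\<exists>B. finite B \<and> card B < k \<and> range (cblinfun_apply F) \<subseteq> cspan B"
    by (auto simp: finite_rank_less_def)
next
  assume "\<exists>B. finite B \<and> card B < k \<and> range (cblinfun_apply F) \<subseteq> cspan B"
  then obtain B where B: "finite B" "card B < k" "range (cblinfun_apply F) \<subseteq> cspan B"
    by blast
  then show "F \<in> finite_rank_less k"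
    using complex_vector.dim_le_card[OF B(3,1)]
    by (auto simp: finite_rank_less_def finite_cdim_def)
qed

lemma zero_finite_rank_less: "1 \<le> k \<Longrightarrow> 0 \<in> finite_rank_less k"
  unfolding finite_rank_less_iff by (intro exI[of _ "{}"]) (auto simp: zero_cblinfun.rep_eq)

lemma finite_rank_less_compose:
  assumes "F \<in> finite_rank_less k"
  shows "A o\<^sub>C F o\<^sub>C B \<in> finite_rank_less k"
proof -
  obtain D where D: "finite D" "card D < k" "range (cblinfun_apply F) \<subseteq> cspan D"
    using assms by (auto simp: finite_rank_less_iff)
  have "cblinfun_apply A v \<in> cspan (cblinfun_apply A ` D)" if "v \<in> cspan D" for v
    using that
    by (induction v rule: complex_vector.span_induct_alt)
      (auto simp: cblinfun_add_right cblinfun_scaleC_right intro!: complex_vector.span_add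
        complex_vector.span_scale complex_vector.span_zero intro: complex_vector.span_base)
  then have "range (cblinfun_apply (A o\<^sub>C F o\<^sub>C B)) \<subseteq> cspan (cblinfun_apply A ` D)"
    using D(3) by (auto simp: cblinfun_compose.rep_eq)
  moreover have "card (cblinfun_apply A ` D) < k"
    using card_image_le[OF D(1)] D(2) by (rule le_less_trans)
  ultimately show ?thesis
    using D(1) by (auto simp: finite_rank_less_iff)
qed

section \<open>Approximation numbers\<close>

lemma approx_number_le:
  "F \<in> finite_rank_less k \<Longrightarrow> approx_number k T \<le> norm (T - F)"
  unfolding approx_number_def by (intro cINF_lower bdd_belowI2[where m = 0]) auto

lemma approx_number_greatest:
  assumes "1 \<le> k" "\<And>F. F \<in> finite_rank_less k \<Longrightarrow> m \<le> norm (T - F)"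
  shows "m \<le> approx_number k T"
  unfolding approx_number_def using zero_finite_rank_less[OF assms(1)] assms(2)
  by (intro cINF_greatest) auto

text \<open>Each competitor \<open>F\<close> for \<open>S\<close> yields the competitor
  \<open>A o\<^sub>C F o\<^sub>C B\<close>, and the error grows at most by the factor
  \<open>norm A * norm B\<close>.\<close>

lemma approx_number_compose_le:
  fixes S :: "'a::complex_normed_vector \<Rightarrow>\<^sub>C\<^sub>L 'b::complex_normed_vector"
  assumes "1 \<le> k" and AB: "norm A * norm B \<le> 1"
  shows "approx_number k (A o\<^sub>C S o\<^sub>C B) \<le> approx_number k S"
proof (rule approx_number_greatest[OF assms(1)])
  fix F :: "'a \<Rightarrow>\<^sub>C\<^sub>L 'b" assume "F \<in> finite_rank_less k"
  then have "approx_number k (A o\<^sub>C S o\<^sub>C B) \<le> norm (A o\<^sub>C S o\<^sub>C B - A o\<^sub>C F o\<^sub>C B)"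
    by (intro approx_number_le finite_rank_less_compose)
  also have "A o\<^sub>C S o\<^sub>C B - A o\<^sub>C F o\<^sub>C B = A o\<^sub>C (S - F) o\<^sub>C B"
    by (rule cblinfun_eqI) (simp add: cblinfun_compose.rep_eq minus_cblinfun.rep_eq cblinfun_diff_right)
  also have "norm \<dots> \<le> norm A * norm (S - F) * norm B"
    by (meson norm_cblinfun_compose mult_right_mono norm_ge_zero order_trans)
  also have "\<dots> \<le> norm (S - F)"
    using mult_right_mono[OF AB, of "norm (S - F)"] by (simp add: mult_ac)
  finally show "approx_number k (A o\<^sub>C S o\<^sub>C B) \<le> norm (S - F)" .
qed

text \<open>A matrix whose rows differ from those of the identity by less than 1 in the sum norm is
  injective, so the \<open>y j\<close> are independent. The strict inequality is stable under
  pointwise limits, which is how rank bounds pass to a limit operator.\<close>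

lemma near_identity_le_card:
  fixes f :: "nat \<Rightarrow> 'v::complex_vector \<Rightarrow> complex" and y :: "nat \<Rightarrow> 'v"
  assumes f: "\<And>i u v. f i (u + v) = f i u + f i v" "\<And>i c v. f i (c *\<^sub>C v) = c * f i v"
    and B: "finite B" "\<And>j. j < k \<Longrightarrow> y j \<in> cspan B"
    and near: "\<And>i. i < k \<Longrightarrow> (\<Sum>j<k. cmod ((if i = j then 1 else 0) - f i (y j))) < 1"
  shows "k \<le> card B"
proof -
  have triv: "\<alpha> l = 0" if \<alpha>: "(\<Sum>j<k. \<alpha> j *\<^sub>C y j) = 0" and l: "l < k" for \<alpha> l
  proof -
    define m where "m = Max ((\<lambda>j. cmod (\<alpha> j)) ` {..<k})"
    have m: "cmod (\<alpha> j) \<le> m" if "j < k" for j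
      unfolding m_def using that by (intro Max_ge) auto
    have "m \<in> (\<lambda>j. cmod (\<alpha> j)) ` {..<k}"
      unfolding m_def using l by (intro Max_in) auto
    \<comment> \<open>Row \<open>i\<close> is chosen at a coefficient of largest modulus; reading
      the relation there gives \<open>m\<close> at most \<open>m\<close> times a number below
      1.\<close>
    then obtain i where i: "i < k" "cmod (\<alpha> i) = m" by auto
    have "f i 0 = 0" using f(1)[of i 0 0] by simp
    then have f_sum: "f i (\<Sum>j\<in>J. \<alpha> j *\<^sub>C y j) = (\<Sum>j\<in>J. \<alpha> j * f i (y j))" for J
      by (induction J rule: infinite_finite_induct) (simp_all add: f)
    have "(\<Sum>j<k. \<alpha> j * f i (y j)) = 0"
      using f_sum[of "{..<k}"] \<alpha> \<open>f i 0 = 0\<close> by simp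
    moreover have "(\<Sum>j<k. \<alpha> j * (if i = j then 1 else 0)) = \<alpha> i"
      using i(1) by (simp add: if_distrib cong: if_cong)
    ultimately have "\<alpha> i = (\<Sum>j<k. \<alpha> j * ((if i = j then 1 else 0) - f i (y j)))"
      by (simp add: right_diff_distrib sum_subtractf)
    then have "m \<le> (\<Sum>j<k. cmod (\<alpha> j * ((if i = j then 1 else 0) - f i (y j))))"
      using i(2) norm_sum by metis
    also have "\<dots> \<le> (\<Sum>j<k. m * cmod ((if i = j then 1 else 0) - f i (y j)))"
      using m by (intro sum_mono) (simp add: norm_mult mult_right_mono)
    also have "\<dots> = m * (\<Sum>j<k. cmod ((if i = j then 1 else 0) - f i (y j)))"
      by (simp add: sum_distrib_left)
    finally have "m \<le> m * (\<Sum>j<k. cmod ((if i = j then 1 else 0) - f i (y j)))" .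
    then have "m \<le> 0"
      using mult_strict_left_mono[OF near[OF i(1)], of m] by (cases "m \<le> 0") auto
    then show "\<alpha> l = 0" using m[OF l] by (meson norm_le_zero_iff order_trans)
  qed
  have inj: "inj_on y {..<k}"
  proof (rule inj_onI, rule ccontr)
    fix i j assume ij: "i \<in> {..<k}" "j \<in> {..<k}" "y i = y j" "i \<noteq> j"
    \<comment> \<open>Independence of a set ignores repetitions, so these are excluded separately: a
      repeated vector gives a relation with coefficients 1 and -1.\<close>
    define \<alpha> :: "nat \<Rightarrow> complex" where "\<alpha> l = (if l = i then 1 else if l = j then - 1 else 0)" for l
    have "(\<Sum>l<k. \<alpha> l *\<^sub>C y l) = (\<Sum>l<k. (if l = i then y i else 0) - (if l = j then y j else 0))"
      using ij(4) by (intro sum.cong) (auto simp: \<alpha>_def scaleC_one)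
    also have "\<dots> = 0"
      using ij by (simp add: sum_subtractf)
    finally have "\<alpha> i = 0" using triv ij(1) by blast
    then show False by (simp add: \<alpha>_def)
  qed
  have "\<not> cdependent (y ` {..<k})"
  proof
    assume "cdependent (y ` {..<k})"
    then obtain u where u: "\<exists>v\<in>y ` {..<k}. u v \<noteq> 0" "(\<Sum>v\<in>y ` {..<k}. u v *\<^sub>C v) = 0"
      by (auto simp: complex_vector.dependent_finite)
    from u(2) have "(\<Sum>j<k. u (y j) *\<^sub>C y j) = 0"
      by (simp add: sum.reindex[OF inj])
    from triv[OF this] u(1) show False by auto
  qed
  moreover have "y ` {..<k} \<subseteq> cspan B" using B(2) by auto
  ultimately have "card (y ` {..<k}) \<le> card B"
    using complex_vector.independent_span_bound[OF B(1)] by blast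
  then show ?thesis by (simp add: card_image[OF inj])
qed

text \<open>A certificate that the \<open>h i\<close> with \<open>i < r\<close> are independent,
  checked at finitely many points.\<close>

definition biorthogonal :: "nat \<Rightarrow> (nat \<Rightarrow> 'x::complex_normed_vector cdual) \<Rightarrow> (nat \<Rightarrow> 'x) \<Rightarrow> bool"
  where "biorthogonal r h x \<longleftrightarrow>
    (\<forall>i<r. \<forall>j<r. cblinfun_apply (h i) (x j) = (if i = j then 1 else 0))"

text \<open>One elimination step: the remainder \<open>g\<close> of \<open>w\<close> vanishes at all
  old points, and a point \<open>z\<close> with \<open>g z \<noteq> 0\<close> can be corrected so
  that all old functionals vanish there. The old system stays unchanged.\<close>

lemma biorthogonal_extend:
  assumes W: "csubspace W" and bi: "biorthogonal r h x" "\<And>i. i < r \<Longrightarrow> h i \<in> W"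
    and w: "w \<in> W" "w \<noteq> (\<Sum>i<r. cblinfun_apply w (x i) *\<^sub>C h i)"
  shows "\<exists>h' x'. biorthogonal (Suc r) h' x' \<and> (\<forall>i<Suc r. h' i \<in> W)"
proof -
  define g where "g = w - (\<Sum>i<r. cblinfun_apply w (x i) *\<^sub>C h i)"
  have gW: "g \<in> W"
    unfolding g_def using W bi(2) w(1)
    by (intro complex_vector.subspace_diff complex_vector.subspace_sum complex_vector.subspace_scale) auto
  have "g \<noteq> 0" using w(2) by (simp add: g_def)
  then obtain z where z: "g z \<noteq> 0"
    using cblinfun_eqI[of g 0] by (auto simp: zero_cblinfun.rep_eq)
  have delta: "h i (x j) = (if i = j then 1 else 0)" if "i < r" "j < r" for i j
    using bi(1) that by (simp add: biorthogonal_def)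
  have gx: "g (x j) = 0" if j: "j < r" for j
  proof -
    have "(\<Sum>i<r. w (x i) * h i (x j)) = (\<Sum>i<r. if i = j then w (x j) else 0)"
      using j by (intro sum.cong) (auto simp: delta)
    also have "\<dots> = w (x j)" using j by simp
    finally show ?thesis
      by (simp add: g_def minus_cblinfun.rep_eq cblinfun_sum_left scaleC_cblinfun.rep_eq)
  qed
  define v where "v = z - (\<Sum>i<r. h i z *\<^sub>C x i)"
  have hv: "h i v = 0" if i: "i < r" for i
  proof -
    have "(\<Sum>j<r. h j z * h i (x j)) = (\<Sum>j<r. if i = j then h i z else 0)"
      using i by (intro sum.cong) (auto simp: delta)
    also have "\<dots> = h i z" using i by simp
    finally show ?thesis
      by (simp add: v_def cblinfun_diff_right cblinfun_sum_right cblinfun_scaleC_right)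
  qed
  have gv: "g v = g z"
    by (simp add: v_def cblinfun_diff_right cblinfun_sum_right cblinfun_scaleC_right gx)
  have "biorthogonal (Suc r) (h(r := inverse (g z) *\<^sub>C g)) (x(r := v))"
    unfolding biorthogonal_def using z
    by (auto simp: less_Suc_eq delta hv gx gv scaleC_cblinfun.rep_eq)
  moreover have "\<forall>i<Suc r. (h(r := inverse (g z) *\<^sub>C g)) i \<in> W"
    using W gW bi(2) by (auto simp: less_Suc_eq intro: complex_vector.subspace_scale)
  ultimately show ?thesis by blast
qed

text \<open>Stop at the last size before systems in \<open>W\<close> first cease to exist: by
  \<open>biorthogonal_extend\<close> no element of \<open>W\<close> can then differ from its
  expansion.\<close>

lemma biorthogonal_maximal:
  assumes W: "csubspace W"
    and no: "\<forall>h x. biorthogonal k h x \<longrightarrow> (\<exists>i<k. h i \<notin> W)"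
  shows "\<exists>r<k. \<exists>h x. \<forall>w\<in>W. w = (\<Sum>i<r. cblinfun_apply w (x i) *\<^sub>C h i)"
proof -
  define E where "E r \<longleftrightarrow> (\<exists>h x. biorthogonal r h x \<and> (\<forall>i<r. h i \<in> W))" for r
  have "E 0" by (simp add: E_def biorthogonal_def)
  moreover have "\<not> E k" using no by (auto simp: E_def)
  ultimately obtain r where "r < k" "E r" "\<not> E (Suc r)"
    using ex_least_nat_less[of "\<lambda>r. \<not> E r" k] by blast
  then obtain h x where h: "biorthogonal r h x" "\<And>i. i < r \<Longrightarrow> h i \<in> W"
    by (auto simp: E_def)
  have "w = (\<Sum>i<r. cblinfun_apply w (x i) *\<^sub>C h i)" if "w \<in> W" for w
    using biorthogonal_extend[OF W h that] \<open>\<not> E (Suc r)\<close> unfolding E_def by blast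
  with \<open>r < k\<close> show ?thesis by blast
qed

lemma csubspace_range_cblinfun: "csubspace (range (cblinfun_apply F))"
  unfolding complex_vector.subspace_def
  by (auto simp: cblinfun_add_right[symmetric] cblinfun_scaleC_right[symmetric]
      intro: range_eqI[of _ _ 0])

text \<open>Turns the rank bound into a test at finitely many points. Evaluations at the
  \<open>x i\<close> give exactly the identity matrix for \<open>near_identity_le_card\<close>;
  conversely, a maximal system in the range spans it.\<close>

lemma finite_rank_less_biorthogonal_iff:
  fixes H :: "'a::complex_normed_vector \<Rightarrow>\<^sub>C\<^sub>L 'x::complex_normed_vector cdual"
  shows "H \<in> finite_rank_less k \<longleftrightarrow>
    (\<forall>h x. biorthogonal k h x \<longrightarrow> (\<exists>i<k. h i \<notin> range (cblinfun_apply H)))"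
proof (intro iffI allI impI)
  fix h :: "nat \<Rightarrow> 'x cdual" and x
  assume "H \<in> finite_rank_less k" and bi: "biorthogonal k h x"
  then obtain B where B: "finite B" "card B < k" "range (cblinfun_apply H) \<subseteq> cspan B"
    by (auto simp: finite_rank_less_iff)
  show "\<exists>i<k. h i \<notin> range (cblinfun_apply H)"
  proof (rule ccontr)
    assume "\<not> ?thesis"
    then have "h j \<in> cspan B" if "j < k" for j using B(3) that by blast
    moreover have "(\<Sum>j<k. cmod ((if i = j then 1 else 0) - cblinfun_apply (h j) (x i))) = 0"
      if "i < k" for i
      using bi that by (intro sum.neutral) (auto simp: biorthogonal_def)
    ultimately have "k \<le> card B"
      using B(1) by (intro near_identity_le_card[where B = B and f = "\<lambda>i g. cblinfun_apply g (x i)" and y = h])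
        (auto simp: plus_cblinfun.rep_eq scaleC_cblinfun.rep_eq simp del: sum.delta)
    with B(2) show False by simp
  qed
next
  assume "\<forall>h x. biorthogonal k h x \<longrightarrow> (\<exists>i<k. h i \<notin> range (cblinfun_apply H))"
  from biorthogonal_maximal[OF csubspace_range_cblinfun this] obtain r h x where r: "r < k"
      and rep: "\<And>w. w \<in> range (cblinfun_apply H) \<Longrightarrow> w = (\<Sum>i<r. cblinfun_apply w (x i) *\<^sub>C h i)"
    by blast
  have "w \<in> cspan (h ` {..<r})" if "w \<in> range (cblinfun_apply H)" for w
  proof -
    have "(\<Sum>i<r. cblinfun_apply w (x i) *\<^sub>C h i) \<in> cspan (h ` {..<r})"
      by (rule complex_vector.span_sum)
        (rule complex_vector.span_scale, rule complex_vector.span_base, rule imageI)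
    then show ?thesis using rep[OF that] by simp
  qed
  moreover have "card (h ` {..<r}) < k"
    using card_image_le[of "{..<r}" h] r by simp
  ultimately show "H \<in> finite_rank_less k"
    unfolding finite_rank_less_iff by (intro exI[of _ "h ` {..<r}"]) auto
qed

section \<open>Compact operators and their adjoints\<close>

lift_definition cbidual_embed :: "'a::complex_normed_vector \<Rightarrow> 'a cdual cdual"
  is "\<lambda>x f. cblinfun_apply f x"
proof -
  fix x :: 'a
  show "bounded_clinear (\<lambda>f :: 'a cdual. f x)"
    by (rule bounded_clinear_intro[where K = "norm x"])
      (simp_all add: plus_cblinfun.rep_eq scaleC_cblinfun.rep_eq, metis norm_cblinfun mult.commute)
qed

text \<open>Total boundedness in the form of a labelling, so that labels for several maps can be
  combined into one tuple.\<close>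

lemma compact_finite_labels:
  fixes g :: "'a \<Rightarrow> 'b::metric_space"
  assumes "compact K" "\<And>x. x \<in> S \<Longrightarrow> g x \<in> K" "0 < \<delta>"
  shows "\<exists>\<kappa> A. finite A \<and> (\<forall>x\<in>S. \<kappa> x \<in> A \<and> dist (g x) (\<kappa> x) < \<delta>)"
proof -
  obtain A where A: "finite A" "K \<subseteq> (\<Union>a\<in>A. ball a \<delta>)"
    using assms(1,3) compact_eq_totally_bounded[of K] by blast
  then have "\<forall>x\<in>S. \<exists>a. a \<in> A \<and> dist (g x) a < \<delta>"
    using assms(2) by (force simp: dist_commute)
  with A(1) show ?thesis by metis
qed

text \<open>Label each point by its approximate values under \<open>T\<close> and under the scalar
  functionals \<open>h j\<close>. Only finitely many joint labels occur, and points with the same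
  label have values within \<open>\<delta>\<close> of each other.\<close>

lemma compact_operator_net:
  fixes r :: nat
  assumes T: "compact_operator T" and \<delta>: "0 < \<delta>"
  obtains N where "finite N" "N \<subseteq> cball 0 1"
    "\<And>x. x \<in> cball 0 1 \<Longrightarrow> \<exists>z\<in>N. norm (cblinfun_apply T x - cblinfun_apply T z) < \<delta> \<and>
      (\<forall>j<r. cmod (cblinfun_apply (h j) x - cblinfun_apply (h j) z) < \<delta>)"
proof -
  let ?S = "cball 0 1 :: 'a set"
  have "compact (closure (cblinfun_apply T ` ?S))"
    using T by (simp add: compact_operator_def)
  moreover have "cblinfun_apply T x \<in> closure (cblinfun_apply T ` ?S)" if "x \<in> ?S" for x
    using that by (intro closure_subset[THEN subsetD]) auto
  ultimately obtain \<kappa> A where A: "finite A" "\<And>x. x \<in> ?S \<Longrightarrow> \<kappa> x \<in> A"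
      "\<And>x. x \<in> ?S \<Longrightarrow> dist (cblinfun_apply T x) (\<kappa> x) < \<delta> / 2"
    using compact_finite_labels[of _ ?S "cblinfun_apply T" "\<delta> / 2"] half_gt_zero[OF \<delta>] by metis
  have "\<exists>\<kappa> A. finite A \<and> (\<forall>x\<in>?S. \<kappa> x \<in> A \<and> dist (cblinfun_apply (h j) x) (\<kappa> x) < \<delta> / 2)" for j
  proof -
    have "cblinfun_apply (h j) x \<in> cball 0 (norm (h j))" if "x \<in> ?S" for x
      using norm_cblinfun[of "h j" x] mult_left_mono[of "norm x" 1 "norm (h j)"] that by simp
    then show ?thesis
      using compact_finite_labels[OF compact_cball _ half_gt_zero[OF \<delta>]] by blast
  qed
  then obtain \<kappa>' A' where A': "\<And>j. finite (A' j)" "\<And>j x. x \<in> ?S \<Longrightarrow> \<kappa>' j x \<in> A' j"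
      "\<And>j x. x \<in> ?S \<Longrightarrow> dist (cblinfun_apply (h j) x) (\<kappa>' j x) < \<delta> / 2"
    by metis
  \<comment> \<open>Restriction to \<open>{..<r}\<close> places the labels in a finite product;
    \<open>inv_into\<close> then picks one point of the ball for each label that occurs.\<close>
  define l where "l x = (\<kappa> x, \<lambda>j\<in>{..<r}. \<kappa>' j x)" for x
  have "l ` ?S \<subseteq> A \<times> PiE {..<r} A'"
    using A(2) A'(2) by (simp add: l_def image_subset_iff restrict_PiE_iff)
  then have fin: "finite (l ` ?S)"
    by (rule finite_subset) (intro finite_cartesian_product finite_PiE finite_lessThan A(1) A'(1))
  show thesis
  proof
    show "finite (inv_into ?S l ` l ` ?S)" using fin by (rule finite_imageI)
    show "inv_into ?S l ` l ` ?S \<subseteq> ?S" by (auto intro!: inv_into_into simp del: mem_cball)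
    fix x assume x: "x \<in> ?S"
    define z where "z = inv_into ?S l (l x)"
    have z: "z \<in> ?S"
      unfolding z_def using x by (intro inv_into_into imageI)
    have "l z = l x"
      unfolding z_def using x by (intro f_inv_into_f imageI)
    then have eq: "\<kappa> z = \<kappa> x" and "(\<lambda>j\<in>{..<r}. \<kappa>' j z) = (\<lambda>j\<in>{..<r}. \<kappa>' j x)"
      by (simp_all add: l_def)
    then have eq': "\<kappa>' j z = \<kappa>' j x" if "j < r" for j
      using that by (metis lessThan_iff restrict_apply)
    have "dist (cblinfun_apply T x) (cblinfun_apply T z) < \<delta>"
      using A(3)[OF x] A(3)[OF z] eq by (metis dist_triangle_half_l)
    moreover have "dist (cblinfun_apply (h j) x) (cblinfun_apply (h j) z) < \<delta>" if "j < r" for j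
      using A'(3)[OF x, of j] A'(3)[OF z, of j] eq'[OF that] by (metis dist_triangle_half_l)
    ultimately show "\<exists>z\<in>inv_into ?S l ` l ` ?S. norm (cblinfun_apply T x - cblinfun_apply T z) < \<delta> \<and>
        (\<forall>j<r. cmod (cblinfun_apply (h j) x - cblinfun_apply (h j) z) < \<delta>)"
      using x by (intro bexI[of _ z]) (auto simp: z_def dist_norm)
  qed
qed

lemma norm_cblinfun_bound_unit:
  assumes K: "0 \<le> K" and bound: "\<And>x. norm x \<le> 1 \<Longrightarrow> norm (cblinfun_apply f x) \<le> K"
  shows "norm f \<le> K"
proof (rule norm_cblinfun_bound[OF K])
  fix x
  show "norm (cblinfun_apply f x) \<le> K * norm x"
  proof (cases "x = 0")
    case False
    define t where "t = inverse (norm x)"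
    have t: "0 < t" "t * norm x = 1" using False by (simp_all add: t_def)
    have "norm (cblinfun_apply f (complex_of_real t *\<^sub>C x)) \<le> K"
      using t by (intro bound) (simp add: norm_scaleC)
    then have "t * norm (cblinfun_apply f x) \<le> K"
      using t(1) by (simp add: cblinfun_scaleC_right norm_scaleC)
    then have "norm x * (t * norm (cblinfun_apply f x)) \<le> norm x * K"
      by (rule mult_left_mono) simp
    then show ?thesis
      using t(2) by (simp add: mult.assoc[symmetric] mult.commute)
  qed simp
qed

text \<open>A competitor \<open>H\<close> for the adjoint is turned into a competitor for
  \<open>T\<close> of the form \<open>\<Sum>j<r. h j v *\<^sub>C y j\<close>, with error at most
  \<open>\<epsilon>\<close> larger.\<close>

theorem approx_number_compact_le_adjoint:
  fixes T :: "'x::complex_normed_vector \<Rightarrow>\<^sub>C\<^sub>L 'y::complex_normed_vector"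
  assumes T: "compact_operator T" and k: "1 \<le> k"
  shows "approx_number k T \<le> approx_number k (cadjoint T)"
proof (rule approx_number_greatest[OF k])
  fix H :: "'y cdual \<Rightarrow>\<^sub>C\<^sub>L 'x cdual"
  assume "H \<in> finite_rank_less k"
  then have "\<forall>h x. biorthogonal k h x \<longrightarrow> (\<exists>i<k. h i \<notin> range (cblinfun_apply H))"
    by (simp only: finite_rank_less_biorthogonal_iff)
  from biorthogonal_maximal[OF csubspace_range_cblinfun this] obtain r h x where r: "r < k"
      and rep: "\<And>w. w \<in> range (cblinfun_apply H) \<Longrightarrow> w = (\<Sum>j<r. cblinfun_apply w (x j) *\<^sub>C h j)"
    by blast
  \<comment> \<open>The coefficient of \<open>H g\<close> along \<open>h j\<close> is
    \<open>H g (x j)\<close>; as a function of \<open>g\<close> it belongs to the bidual.\<close>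
  define \<phi> where "\<phi> j = cbidual_embed (x j) o\<^sub>C H" for j
  have \<phi>: "\<phi> j g = H g (x j)" for j g
    by (simp add: \<phi>_def cblinfun_compose.rep_eq cbidual_embed.rep_eq)
  have H: "H g v = (\<Sum>j<r. h j v * \<phi> j g)" for g v
    using arg_cong[OF rep[of "H g"], of "\<lambda>w. cblinfun_apply w v"]
    by (simp add: cblinfun_sum_left scaleC_cblinfun.rep_eq \<phi> mult.commute)
  define d where "d = norm (cadjoint T - H)"
  define M where "M = (\<Sum>j<r. norm (\<phi> j))"
  have M: "norm (\<phi> j) \<le> M" if "j < r" for j
    unfolding M_def using that by (intro member_le_sum) auto
  have M0: "0 \<le> M" unfolding M_def by (intro sum_nonneg) auto
  show "approx_number k T \<le> d"
  proof (rule field_le_epsilon)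
    fix \<epsilon> :: real assume \<epsilon>: "0 < \<epsilon>"
    \<comment> \<open>\<open>\<delta> * D\<close> covers the move from a point to the net:
      \<open>\<delta>\<close> for \<open>T\<close> and \<open>\<delta> * (M + 1)\<close> for each of
      the \<open>r\<close> terms of \<open>F\<close>. The other \<open>\<epsilon> / 2\<close> is the
      loss in \<open>Helly_bidual\<close>.\<close>
    define D where "D = 1 + real r * (M + 1)"
    have D: "0 < D"
      unfolding D_def using M0 by (intro add_pos_nonneg) auto
    define \<delta> where "\<delta> = \<epsilon> / 2 / D"
    have \<delta>: "0 < \<delta>" "\<delta> * D = \<epsilon> / 2"
      using D \<epsilon> by (simp_all add: \<delta>_def)
    then have \<delta>_sum: "\<delta> + real r * (\<delta> * (M + 1)) = \<epsilon> / 2"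
      by (simp add: D_def algebra_simps)
    obtain N where N: "finite N" "N \<subseteq> cball 0 1"
      and net: "\<And>x. x \<in> cball 0 1 \<Longrightarrow> \<exists>z\<in>N. norm (cblinfun_apply T x - cblinfun_apply T z) < \<delta> \<and>
        (\<forall>j<r. cmod (cblinfun_apply (h j) x - cblinfun_apply (h j) z) < \<delta>)"
      using compact_operator_net[OF T \<delta>(1)] by metis
    \<comment> \<open>the indices \<open>Inr l\<close> bound the norms of the \<open>y l\<close>, which is what makes the net suffice\<close>
    define I where "I = Inl ` N \<union> Inr ` {..<r}"
    define b where "b = case_sum (cblinfun_apply T) (\<lambda>l :: nat. 0)"
    \<comment> \<open>As \<open>b\<close> is 0 at \<open>Inr l\<close>, the entry \<open>- 1\<close>
      there leaves just \<open>y l\<close> inside the norm; at \<open>Inl z\<close> the norm is the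
      error at \<open>z\<close>.\<close>
    define a where "a i j = (case i of Inl z \<Rightarrow> cblinfun_apply (h j) z
      | Inr l \<Rightarrow> if l = j then - 1 else 0)" for i :: "'x + nat" and j
    have "\<exists>y. \<forall>i\<in>I. norm (b i - (\<Sum>j<r. a i j *\<^sub>C y j))
        < case_sum (\<lambda>_. d + \<epsilon> / 2) (\<lambda>_. M + 1) i"
    proof (rule Helly_bidual[where I = I and d = "case_sum (\<lambda>_. d) (\<lambda>_. M)"
          and c = "case_sum (\<lambda>_. d + \<epsilon> / 2) (\<lambda>_. M + 1)" and b = b and r = r and a = a and \<phi> = \<phi>])
      show "finite I" using N(1) by (simp add: I_def)
      show "0 \<le> case_sum (\<lambda>_. d) (\<lambda>_. M) i" if "i \<in> I" for i
        using M0 by (simp add: d_def split: sum.split)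
      show "case_sum (\<lambda>_. d) (\<lambda>_. M) i < case_sum (\<lambda>_. d + \<epsilon> / 2) (\<lambda>_. M + 1) i" if "i \<in> I" for i
        using \<epsilon> by (simp split: sum.split)
      show "cmod (cblinfun_apply g (b i) - (\<Sum>j<r. a i j * \<phi> j g)) \<le> case_sum (\<lambda>_. d) (\<lambda>_. M) i * norm g"
        if i: "i \<in> I" for i g
      proof (cases i)
        case (Inl z)
        with i N(2) have z: "norm z \<le> 1" by (auto simp: I_def)
        have "cmod (g (b i) - (\<Sum>j<r. a i j * \<phi> j g)) = cmod ((cadjoint T - H) g z)"
          by (simp add: Inl a_def b_def H minus_cblinfun.rep_eq cadjoint_apply)
        also have "\<dots> \<le> norm ((cadjoint T - H) g) * norm z"
          by (rule norm_cblinfun)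
        also have "\<dots> \<le> norm ((cadjoint T - H) g)"
          using z by (simp add: mult_left_le)
        also have "\<dots> \<le> d * norm g"
          unfolding d_def by (rule norm_cblinfun)
        finally show ?thesis by (simp add: Inl)
      next
        case (Inr l)
        with i have l: "l < r" by (auto simp: I_def)
        have "(\<Sum>j<r. a i j * \<phi> j g) = (\<Sum>j<r. if l = j then - \<phi> l g else 0)"
          by (intro sum.cong) (auto simp: a_def Inr)
        then have "cmod (g (b i) - (\<Sum>j<r. a i j * \<phi> j g)) = cmod (\<phi> l g)"
          using l by (simp add: Inr b_def)
        also have "\<dots> \<le> norm (\<phi> l) * norm g" by (rule norm_cblinfun)
        also have "\<dots> \<le> M * norm g" using M[OF l] by (intro mult_right_mono) auto
        finally show ?thesis by (simp add: Inr)
      qed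
    qed blast
    then obtain y where y: "\<And>i. i \<in> I \<Longrightarrow> norm (b i - (\<Sum>j<r. a i j *\<^sub>C y j))
        < case_sum (\<lambda>_. d + \<epsilon> / 2) (\<lambda>_. M + 1) i"
      by blast
    have y_net: "norm (T z - (\<Sum>j<r. h j z *\<^sub>C y j)) < d + \<epsilon> / 2" if "z \<in> N" for z
      using y[of "Inl z"] that by (simp add: I_def a_def b_def)
    have y_M: "norm (y l) \<le> M + 1" if l: "l < r" for l
    proof -
      have "(\<Sum>j<r. a (Inr l) j *\<^sub>C y j) = (\<Sum>j<r. if l = j then - y l else 0)"
        by (intro sum.cong) (auto simp: a_def scaleC_one)
      then show ?thesis
        using y[of "Inr l"] l by (simp add: I_def b_def)
    qed
    define F where "F = CBlinfun (\<lambda>v. \<Sum>j<r. h j v *\<^sub>C y j)"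
    have "bounded_clinear (\<lambda>v. \<Sum>j<r. h j v *\<^sub>C y j)"
    proof (rule bounded_clinear_intro[where K = "\<Sum>j<r. norm (h j) * norm (y j)"])
      show "(\<Sum>j<r. h j (u + v) *\<^sub>C y j) = (\<Sum>j<r. h j u *\<^sub>C y j) + (\<Sum>j<r. h j v *\<^sub>C y j)" for u v
        by (simp add: cblinfun_add_right scaleC_add_left sum.distrib)
      show "(\<Sum>j<r. h j (c *\<^sub>C v) *\<^sub>C y j) = c *\<^sub>C (\<Sum>j<r. h j v *\<^sub>C y j)" for c v
        by (simp add: cblinfun_scaleC_right complex_vector.scale_sum_right scaleC_scaleC)
      show "norm (\<Sum>j<r. h j v *\<^sub>C y j) \<le> (\<Sum>j<r. norm (h j) * norm (y j)) * norm v" for v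
        unfolding sum_distrib_right
      proof (rule sum_norm_le)
        show "norm (h j v *\<^sub>C y j) \<le> norm (h j) * norm (y j) * norm v" for j
          using mult_right_mono[OF norm_cblinfun[of "h j" v] norm_ge_zero[of "y j"]]
          by (simp add: norm_scaleC mult_ac)
      qed
    qed
    then have F: "cblinfun_apply F = (\<lambda>v. \<Sum>j<r. h j v *\<^sub>C y j)"
      by (simp add: F_def CBlinfun_inverse)
    have "range (cblinfun_apply F) \<subseteq> cspan (y ` {..<r})"
      unfolding F
    proof (rule image_subsetI)
      show "(\<Sum>j<r. h j v *\<^sub>C y j) \<in> cspan (y ` {..<r})" for v
        by (rule complex_vector.span_sum)
          (rule complex_vector.span_scale, rule complex_vector.span_base, rule imageI)
    qed
    moreover have "card (y ` {..<r}) < k"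
      using card_image_le[of "{..<r}" y] r by simp
    ultimately have "F \<in> finite_rank_less k"
      unfolding finite_rank_less_iff by (intro exI[of _ "y ` {..<r}"]) auto
    then have "approx_number k T \<le> norm (T - F)"
      by (rule approx_number_le)
    also have "\<dots> \<le> d + \<epsilon>"
    proof (rule norm_cblinfun_bound_unit)
      show "0 \<le> d + \<epsilon>" using \<epsilon> by (simp add: d_def)
      fix v :: 'x assume "norm v \<le> 1"
      then obtain z where z: "z \<in> N" "norm (T v - T z) < \<delta>"
          "\<And>j. j < r \<Longrightarrow> cmod (h j v - h j z) < \<delta>"
        using net[of v] by auto
      have "norm (F z - F v) = norm (\<Sum>j<r. (h j z - h j v) *\<^sub>C y j)"
        by (simp add: F complex_vector.scale_left_diff_distrib sum_subtractf)
      also have "\<dots> \<le> (\<Sum>j<r. \<delta> * (M + 1))"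
      proof (rule sum_norm_le)
        fix j assume j: "j \<in> {..<r}"
        then show "norm ((h j z - h j v) *\<^sub>C y j) \<le> \<delta> * (M + 1)"
          using z(3)[of j] y_M[of j] \<delta>(1)
          by (auto simp: norm_scaleC norm_minus_commute intro!: mult_mono)
      qed
      finally have "norm (F z - F v) \<le> real r * (\<delta> * (M + 1))" by simp
      moreover have "norm (T z - F z) < d + \<epsilon> / 2"
        using y_net[OF z(1)] by (simp add: F)
      moreover have "(T - F) v = (T v - T z) + ((T z - F z) + (F z - F v))"
        by (simp add: minus_cblinfun.rep_eq)
      ultimately show "norm ((T - F) v) \<le> d + \<epsilon>"
        using z(2) \<delta>_sum norm_triangle_ineq[of "T v - T z" "(T z - F z) + (F z - F v)"]
          norm_triangle_ineq[of "T z - F z" "F z - F v"]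
        by simp
    qed
    finally show "approx_number k T \<le> d + \<epsilon>" .
  qed
qed

section \<open>Weak limits\<close>

text \<open>The \<open>s n\<close> lie in a product of discs, compact by Tychonoff. A finer filter
  takes the place of a subsequence, since \<open>'i\<close> may be uncountable.\<close>

lemma pointwise_bounded_limit:
  fixes s :: "'n \<Rightarrow> 'i \<Rightarrow> complex"
  assumes F: "F \<noteq> bot" and bound: "\<And>n i. cmod (s n i) \<le> K i"
  shows "\<exists>G h. G \<le> F \<and> G \<noteq> bot \<and> (\<forall>i. ((\<lambda>n. s n i) \<longlongrightarrow> h i) G)"
proof -
  let ?U = "PiE UNIV (\<lambda>i. cball (0 :: complex) (K i))"
  have "compactin (product_topology (\<lambda>i. euclidean) UNIV) ?U"
    by (simp add: compactin_PiE)
  then have "compact ?U"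
    by (simp add: euclidean_product_topology)
  moreover have "eventually (\<lambda>z. z \<in> ?U) (filtermap s F)"
    by (simp add: eventually_filtermap PiE_UNIV_domain bound)
  ultimately obtain h where h: "inf (nhds h) (filtermap s F) \<noteq> bot"
    using F unfolding compact_filter by (metis filtermap_bot_iff)
  \<comment> \<open>Adding the preimages of the neighbourhoods of \<open>h\<close> keeps the filter
    proper because \<open>h\<close> is a cluster point.\<close>
  define G where "G = inf F (filtercomap s (nhds h))"
  have "G \<noteq> bot"
  proof
    assume "G = bot"
    then have "eventually (\<lambda>n. False) (inf F (filtercomap s (nhds h)))"
      by (simp add: G_def)
    then obtain P R where P: "eventually P F" and R: "eventually R (nhds h)"
        and PR: "\<And>n. P n \<Longrightarrow> R (s n) \<Longrightarrow> False"
      unfolding eventually_inf eventually_filtercomap by blast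
    have "eventually (\<lambda>z. \<not> R z) (filtermap s F)"
      unfolding eventually_filtermap using P by (rule eventually_mono) (use PR in blast)
    with R have "eventually (\<lambda>z. False) (inf (nhds h) (filtermap s F))"
      unfolding eventually_inf by blast
    with h show False by (simp add: trivial_limit_def)
  qed
  moreover have "((\<lambda>n. s n i) \<longlongrightarrow> h i) G" for i
  proof -
    have "filterlim s (nhds h) G"
      using filterlim_filtercomap[of s "nhds h"] unfolding G_def
      by (rule filterlim_mono) auto
    moreover have "filterlim (\<lambda>z. z i) (nhds (h i)) (nhds h)"
    proof (rule topological_tendstoI)
      fix U assume "open U" "h i \<in> U"
      then show "eventually (\<lambda>z. z i \<in> U) (nhds h)"
        unfolding eventually_nhds
        using open_vimage[OF _ continuous_on_product_coordinates, of U i]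
        by (intro exI[of _ "(\<lambda>z. z i) -` U"]) auto
    qed
    ultimately show ?thesis
      by (rule filterlim_compose[rotated])
  qed
  ultimately show ?thesis
    by (intro exI[of _ G] exI[of _ h]) (simp add: G_def)
qed

text \<open>The bound \<open>K\<close> confines every \<open>f (R n x)\<close> to a disc, so these
  forms converge along a finer filter. Bilinearity and the error bound \<open>L\<close> survive
  pointwise limits, and the rank bound is tested on finitely many pairs.\<close>

theorem approx_number_adjoint_weak_limit:
  fixes T :: "'x::complex_normed_vector \<Rightarrow>\<^sub>C\<^sub>L 'y::complex_normed_vector"
    and S R :: "'n \<Rightarrow> ('x \<Rightarrow>\<^sub>C\<^sub>L 'y)"
  assumes F: "F \<noteq> bot"
    and weak: "\<And>(f :: 'y cdual) x. ((\<lambda>n. cblinfun_apply f (cblinfun_apply (S n) x)) \<longlongrightarrow> f (T x)) F"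
    and R: "\<And>n. R n \<in> finite_rank_less k" "\<And>n. norm (R n) \<le> K"
    and L: "eventually (\<lambda>n. norm (S n - R n) \<le> L) F"
  shows "approx_number k (cadjoint T) \<le> L"
proof -
  have bound: "cmod (cblinfun_apply f (R n x)) \<le> norm f * (K * norm x)" for f :: "'y cdual" and n x
  proof -
    have "cmod (cblinfun_apply f (R n x)) \<le> norm f * norm (R n x)"
      by (rule norm_cblinfun)
    also have "\<dots> \<le> norm f * (K * norm x)"
      using norm_cblinfun[of "R n" x] mult_right_mono[OF R(2)[of n], of "norm x"]
      by (intro mult_left_mono) auto
    finally show ?thesis .
  qed
  have "\<exists>G (h :: 'y cdual \<times> 'x \<Rightarrow> complex). G \<le> F \<and> G \<noteq> bot \<and>
      (\<forall>i. ((\<lambda>n. cblinfun_apply (fst i) (R n (snd i))) \<longlongrightarrow> h i) G)"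
    using pointwise_bounded_limit[OF F, of "\<lambda>n i. cblinfun_apply (fst i) (R n (snd i))", OF bound] .
  then obtain G and h :: "'y cdual \<times> 'x \<Rightarrow> complex" where G: "G \<le> F" "G \<noteq> bot"
      and "\<forall>i. ((\<lambda>n. cblinfun_apply (fst i) (R n (snd i))) \<longlongrightarrow> h i) G"
    by blast
  then have h: "((\<lambda>n. cblinfun_apply f (R n x)) \<longlongrightarrow> h (f, x)) G" for f :: "'y cdual" and x
    by (metis fst_conv snd_conv)
  have L': "eventually (\<lambda>n. norm (S n - R n) \<le> L) G"
    using L G(1) by (rule filter_leD[rotated])
  have L0: "0 \<le> L"
    using eventually_happens'[OF G(2) L'] norm_ge_zero by (meson order_trans)
  have uniq: "l = l'" if "(u \<longlongrightarrow> l) G" "(u \<longlongrightarrow> l') G" for u :: "'n \<Rightarrow> complex" and l l'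
    using tendsto_unique[OF G(2) that] .
  have h_add: "h (f, x + x') = h (f, x) + h (f, x')" for f x x'
    using tendsto_add[OF h[of f x] h[of f x']]
    by (intro uniq[OF h]) (simp add: cblinfun_add_right)
  have h_scale: "h (f, c *\<^sub>C x) = c * h (f, x)" for f c x
    using tendsto_mult_left[OF h[of f x], of c]
    by (intro uniq[OF h]) (simp add: cblinfun_scaleC_right)
  have h_add': "h (f + f', x) = h (f, x) + h (f', x)" for f f' x
    using tendsto_add[OF h[of f x] h[of f' x]]
    by (intro uniq[OF h]) (simp add: plus_cblinfun.rep_eq)
  have h_scale': "h (c *\<^sub>C f, x) = c * h (f, x)" for f c x
    using tendsto_mult_left[OF h[of f x], of c]
    by (intro uniq[OF h]) (simp add: scaleC_cblinfun.rep_eq)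
  have h_bound: "cmod (h (f, x)) \<le> norm f * (K * norm x)" for f x
    using tendsto_upperbound[OF tendsto_norm[OF h[of f x]] always_eventually G(2)] bound by blast
  have K0: "0 \<le> K" using R(2) norm_ge_zero by (meson order_trans)
  define H0 where "H0 f = CBlinfun (\<lambda>x. h (f, x))" for f
  have H0: "cblinfun_apply (H0 f) x = h (f, x)" for f x
  proof -
    have "bounded_clinear (\<lambda>x. h (f, x))"
      by (rule bounded_clinear_intro[where K = "norm f * K"])
        (use h_bound in \<open>auto simp: h_add h_scale mult.assoc\<close>)
    then show ?thesis by (simp add: H0_def CBlinfun_inverse)
  qed
  define H where "H = CBlinfun H0"
  have "bounded_clinear H0"
  proof (rule bounded_clinear_intro[where K = K])
    show "H0 (f + f') = H0 f + H0 f'" for f f'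
      by (rule cblinfun_eqI) (simp add: H0 plus_cblinfun.rep_eq h_add')
    show "H0 (c *\<^sub>C f) = c *\<^sub>C H0 f" for c f
      by (rule cblinfun_eqI) (simp add: H0 scaleC_cblinfun.rep_eq h_scale')
    show "norm (H0 f) \<le> K * norm f" for f
      by (rule norm_cblinfun_bound) (use h_bound[of f] K0 in \<open>auto simp: H0 mult_ac\<close>)
  qed
  then have H: "cblinfun_apply (cblinfun_apply H f) x = h (f, x)" for f x
    by (simp add: H_def CBlinfun_inverse H0)

  have "H \<in> finite_rank_less k"
    unfolding finite_rank_less_biorthogonal_iff
  proof (intro allI impI, rule ccontr)
    fix g x assume bi: "biorthogonal k g x" and "\<not> (\<exists>i<k. g i \<notin> range (cblinfun_apply H))"
    then have "\<forall>i\<in>{..<k}. \<exists>f. g i = cblinfun_apply H f"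
      by blast
    from bchoice[OF this] obtain f where f: "\<And>i. i < k \<Longrightarrow> g i = cblinfun_apply H (f i)"
      by blast
    \<comment> \<open>The limit matrix \<open>h (f i, x j)\<close> is the identity, so along
      \<open>G\<close> the matrices of \<open>R n\<close> come close to it, which forces rank at
      least \<open>k\<close>.\<close>
    have "eventually (\<lambda>n. \<forall>i\<in>{..<k}.
        (\<Sum>j<k. cmod ((if i = j then 1 else 0) - cblinfun_apply (f i) (R n (x j)))) < 1) G"
    proof (rule eventually_ball_finite[OF finite_lessThan], rule ballI)
      fix i assume i: "i \<in> {..<k}"
      have "((\<lambda>n. \<Sum>j<k. cmod ((if i = j then 1 else 0) - cblinfun_apply (f i) (R n (x j))))
          \<longlongrightarrow> (\<Sum>j<k. cmod ((if i = j then 1 else 0) - h (f i, x j)))) G"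
        by (intro tendsto_intros h)
      moreover have "h (f i, x j) = (if i = j then 1 else 0)" if "j < k" for j
      proof -
        have "cblinfun_apply (g i) (x j) = (if i = j then 1 else 0)"
          using bi i that by (simp add: biorthogonal_def)
        then show ?thesis using i by (simp only: f H lessThan_iff)
      qed
      then have "(\<Sum>j<k. cmod ((if i = j then 1 else 0) - h (f i, x j))) = 0"
        by (intro sum.neutral) simp
      then have "(\<Sum>j<k. cmod ((if i = j then 1 else 0) - h (f i, x j))) < 1"
        by simp
      ultimately show "eventually (\<lambda>n.
          (\<Sum>j<k. cmod ((if i = j then 1 else 0) - cblinfun_apply (f i) (R n (x j)))) < 1) G"
        by (rule order_tendstoD(2))
    qed
    from eventually_happens'[OF G(2) this] obtain n where n: "\<And>i. i < k \<Longrightarrow>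
        (\<Sum>j<k. cmod ((if i = j then 1 else 0) - cblinfun_apply (f i) (R n (x j)))) < 1"
      by blast
    obtain B where B: "finite B" "card B < k" "range (cblinfun_apply (R n)) \<subseteq> cspan B"
      using R(1)[of n] by (auto simp: finite_rank_less_iff)
    have "k \<le> card B"
      using B(1,3) n by (intro near_identity_le_card[where B = B and f = "\<lambda>i. cblinfun_apply (f i)"
            and y = "\<lambda>j. R n (x j)"]) (auto simp: cblinfun_add_right cblinfun_scaleC_right)
    with B(2) show False by simp
  qed
  then have "approx_number k (cadjoint T) \<le> norm (cadjoint T - H)"
    by (rule approx_number_le)
  also have "\<dots> \<le> L"
  proof (rule norm_cblinfun_bound[OF L0], rule norm_cblinfun_bound)
    fix f :: "'y cdual" and x
    show "0 \<le> L * norm f" using L0 by simp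
    have "((\<lambda>n. cmod (f (S n x) - f (R n x))) \<longlongrightarrow> cmod (f (T x) - h (f, x))) G"
      using weak G(1) by (intro tendsto_intros h) (rule tendsto_mono)
    moreover have "eventually (\<lambda>n. cmod (f (S n x) - f (R n x)) \<le> L * norm f * norm x) G"
      using L'
    proof (rule eventually_mono)
      fix n assume n: "norm (S n - R n) \<le> L"
      have "cmod (f (S n x) - f (R n x)) = cmod (f ((S n - R n) x))"
        by (simp add: minus_cblinfun.rep_eq cblinfun_diff_right)
      also have "\<dots> \<le> norm f * norm ((S n - R n) x)"
        by (rule norm_cblinfun)
      also have "\<dots> \<le> norm f * (L * norm x)"
        using norm_cblinfun[of "S n - R n" x] mult_right_mono[OF n, of "norm x"]
        by (intro mult_left_mono) auto
      finally show "cmod (f (S n x) - f (R n x)) \<le> L * norm f * norm x"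
        by (simp add: mult_ac)
    qed
    ultimately have "cmod (f (T x) - h (f, x)) \<le> L * norm f * norm x"
      using G(2) by (rule tendsto_upperbound)
    then show "norm ((cadjoint T - H) f x) \<le> L * norm f * norm x"
      by (simp add: minus_cblinfun.rep_eq cadjoint_apply H)
  qed
  finally show ?thesis .
qed

section \<open>Adjoints of products and the limit of the approximation numbers\<close>

lemma norm_cadjoint_le: "norm (cadjoint T) \<le> norm T"
proof (rule norm_cblinfun_bound)
  show "norm (cblinfun_apply (cadjoint T) f) \<le> norm T * norm f" for f
    using norm_cblinfun_compose[of f T] by (simp add: cadjoint.rep_eq mult.commute)
qed simp

lemma cadjoint_compose: "cadjoint (A o\<^sub>C B) = cadjoint B o\<^sub>C cadjoint A"
  by (intro cblinfun_eqI) (simp add: cadjoint_apply cblinfun_compose.rep_eq)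

lemma cblinfun_compose_assoc: "A o\<^sub>C (B o\<^sub>C C) = A o\<^sub>C B o\<^sub>C C"
  by (intro cblinfun_eqI) (simp add: cblinfun_compose.rep_eq)

text \<open>The upper bound holds at every index from 1 on. If the lower bound fails at some
  \<open>c < a\<close>, the indices of failure carry a proper filter to which
  \<open>approx_number_adjoint_weak_limit\<close> applies.\<close>

theorem approx_number_tendsto_adjoint:
  fixes T :: "'x::complex_normed_vector \<Rightarrow>\<^sub>C\<^sub>L 'y::complex_normed_vector"
  assumes compact: "\<And>n. n \<ge> 1 \<Longrightarrow> compact_operator (Q n o\<^sub>C T o\<^sub>C P n)"
    and PQ: "\<And>n. n \<ge> 1 \<Longrightarrow> norm (P n) * norm (Q n) \<le> 1"
    and weak: "weak_operator_tendsto (\<lambda>n. Q n o\<^sub>C T o\<^sub>C P n) T"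
    and k: "1 \<le> k"
  shows "(\<lambda>n. approx_number k (Q n o\<^sub>C T o\<^sub>C P n)) \<longlonglongrightarrow> approx_number k (cadjoint T)"
proof -
  define S where "S n = Q n o\<^sub>C T o\<^sub>C P n" for n
  define a where "a = approx_number k (cadjoint T)"
  have upper: "approx_number k (S n) \<le> a" if n: "1 \<le> n" for n
  proof -
    have "approx_number k (S n) \<le> approx_number k (cadjoint (S n))"
      using compact[OF n] k unfolding S_def by (rule approx_number_compact_le_adjoint)
    also have "cadjoint (S n) = cadjoint (P n) o\<^sub>C cadjoint T o\<^sub>C cadjoint (Q n)"
      by (simp add: S_def cadjoint_compose cblinfun_compose_assoc)
    also have "approx_number k \<dots> \<le> a"
      unfolding a_def using k
    proof (rule approx_number_compose_le)
      show "norm (cadjoint (P n)) * norm (cadjoint (Q n)) \<le> 1"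
        using mult_mono[OF norm_cadjoint_le[of "P n"] norm_cadjoint_le[of "Q n"]] PQ[OF n] by simp
    qed
    finally show ?thesis .
  qed
  have S_norm: "norm (S n) \<le> norm T" if n: "1 \<le> n" for n
  proof -
    have "norm (S n) \<le> norm (Q n) * norm T * norm (P n)"
      unfolding S_def by (meson norm_cblinfun_compose mult_right_mono norm_ge_zero order_trans)
    also have "\<dots> \<le> norm T"
      using mult_right_mono[OF PQ[OF n], of "norm T"] by (simp add: mult_ac)
    finally show ?thesis .
  qed
  have "(\<lambda>n. approx_number k (S n)) \<longlonglongrightarrow> a"
  proof (rule order_tendstoI)
    fix c assume c: "a < c"
    show "eventually (\<lambda>n. approx_number k (S n) < c) sequentially"
      using eventually_ge_at_top[of 1] by (rule eventually_mono) (use upper c in force)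
  next
    fix c assume c: "c < a"
    show "eventually (\<lambda>n. c < approx_number k (S n)) sequentially"
    proof (rule ccontr)
      assume not_ev: "\<not> ?thesis"
      define N where "N = {n. 1 \<le> n \<and> approx_number k (S n) \<le> c}"
      define F where "F = inf sequentially (principal N)"
      have "F \<noteq> bot"
      proof
        assume "F = bot"
        then have "eventually (\<lambda>n. n \<notin> N) sequentially"
          by (simp add: F_def trivial_limit_def eventually_inf_principal)
        then have "eventually (\<lambda>n. c < approx_number k (S n)) sequentially"
          using eventually_ge_at_top[of 1] by eventually_elim (auto simp: N_def)
        with not_ev show False by simp
      qed
      \<comment> \<open>The midpoint leaves room on both sides: for \<open>n \<in> N\<close> some
        competitor has error below \<open>L\<close>, while \<open>L < a\<close>.\<close>
      define L where "L = (c + a) / 2"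
      \<comment> \<open>Outside \<open>N\<close> the zero operator serves as a default, so that rank
        and norm bounds hold at every index; the absolute value keeps the norm bound
        nonnegative.\<close>
      have "\<exists>R. R \<in> finite_rank_less k \<and> norm R \<le> \<bar>L\<bar> + norm T \<and> (n \<in> N \<longrightarrow> norm (S n - R) \<le> L)" for n
      proof (cases "n \<in> N")
        case True
        then have "\<not> L \<le> approx_number k (S n)"
          using c by (simp add: N_def L_def)
        then obtain R where R: "R \<in> finite_rank_less k" "norm (S n - R) < L"
          using approx_number_greatest[OF k] by (meson not_le)
        moreover have "norm R \<le> \<bar>L\<bar> + norm T"
          using R(2) S_norm[of n] True norm_triangle_ineq4[of "S n" "S n - R"] by (simp add: N_def)
        ultimately show ?thesis by (meson less_imp_le)
      next
        case False
        then show ?thesis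
          using zero_finite_rank_less[OF k] by (intro exI[of _ 0]) auto
      qed
      then obtain R where R: "\<And>n. R n \<in> finite_rank_less k" "\<And>n. norm (R n) \<le> \<bar>L\<bar> + norm T"
          "\<And>n. n \<in> N \<Longrightarrow> norm (S n - R n) \<le> L"
        by metis
      have "a \<le> L"
        unfolding a_def
      proof (rule approx_number_adjoint_weak_limit[where S = S, OF \<open>F \<noteq> bot\<close> _ R(1,2)])
        show "((\<lambda>n. cblinfun_apply f (S n x)) \<longlongrightarrow> f (T x)) F" for f :: "'y cdual" and x
        proof -
          have "(\<lambda>n. cblinfun_apply f (S n x)) \<longlonglongrightarrow> f (T x)"
            using weak unfolding weak_operator_tendsto_def S_def[symmetric]
            by (subst LIM_zero_iff[symmetric], subst tendsto_norm_zero_iff[symmetric]) blast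
          then show ?thesis
            by (rule tendsto_mono[rotated]) (simp add: F_def)
        qed
        show "eventually (\<lambda>n. norm (S n - R n) \<le> L) F"
          using R(3) by (simp add: F_def eventually_inf_principal)
      qed
      with c show False by (simp add: L_def)
    qed
  qed
  then show ?thesis by (simp add: S_def a_def)
qed

theorem theorem5:
  fixes T :: "'x::complex_normed_vector \<Rightarrow>\<^sub>C\<^sub>L 'y::complex_normed_vector"
    and P :: "nat \<Rightarrow> ('x \<Rightarrow>\<^sub>C\<^sub>L 'x)"
    and Q :: "nat \<Rightarrow> ('y \<Rightarrow>\<^sub>C\<^sub>L 'y)"
  assumes "\<not> finite_cdim (UNIV :: 'x set)"
    and "\<not> finite_cdim (UNIV :: 'y set)"
    and "\<And>n. n \<ge> 1 \<Longrightarrow> compact_operator (Q n o\<^sub>C T o\<^sub>C P n)"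
    and "\<And>n. n \<ge> 1 \<Longrightarrow> norm (P n) * norm (Q n) \<le> 1"
    and "weak_operator_tendsto (\<lambda>n. Q n o\<^sub>C T o\<^sub>C P n) T"
  shows "\<forall>k\<ge>1. ((\<lambda>n. approx_number k (Q n o\<^sub>C T o\<^sub>C P n)) \<longlonglongrightarrow> approx_number k T) \<longleftrightarrow>
    approx_number k T = approx_number k (cadjoint T)"
proof (intro allI impI)
  fix k :: nat assume "1 \<le> k"
  then have "(\<lambda>n. approx_number k (Q n o\<^sub>C T o\<^sub>C P n)) \<longlonglongrightarrow> approx_number k (cadjoint T)"
    using assms(3-5) by (intro approx_number_tendsto_adjoint)
  then show "((\<lambda>n. approx_number k (Q n o\<^sub>C T o\<^sub>C P n)) \<longlonglongrightarrow> approx_number k T) \<longleftrightarrow>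
      approx_number k T = approx_number k (cadjoint T)"
    using LIMSEQ_unique by force
qed

end
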